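(* Let $g$ be an admissible free holomorphic function with associated weighted left creation operators ${\bf W}=(W_1,\ldots,W_n)$ and let $T=(T_1,\ldots,T_n)\in B(\mathcal H)^n$. Then there is a Hilbert space $\mathcal D$ such that $$T_i^*=(W_i^*\otimes I_{\mathcal D})|_{\mathcal H},\qquad i\in\{1,\ldots,n\},$$ where $\mathcal H$ is identified (via an isometry $\mathcal H\to F^2(H_n)\otimes\mathcal D$) with a coinvariant subspace for the operators $W_1\otimes I_{\mathcal D},\ldots,W_n\otimes I_{\mathcal D}$, if and only if $T$ is a pure $n$-tuple in the noncommutative set $\mathcal D_{g^{-1}}(\mathcal H)$. In this case, with $\mathcal D:=\overline{\Delta_{g^{-1}}(T,T^* )\mathcal H}$, we have $$K_{g,T}T_i^*=(W_i^*\otimes I_{\mathcal D})K_{g,T},\qquad i\in\{1,\ldots,n\},$$ and the noncommutative Berezin kernel $K_{g,T}$ is an isometry.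
   Context: $\mathbb F_n^+$ is the unital free semigroup on generators $g_1,\ldots,g_n$ with identity $g_0$, and $|\alpha|$ is the length of $\alpha$. For $\alpha=g_{i_1}\cdots g_{i_k}$, $X_\alpha:=X_{i_1}\cdots X_{i_k}$, $X_{g_0}:=I$. $F^2(H_n)$ is the full Fock space with orthonormal basis $\{e_\alpha\}_{\alpha\in\mathbb F_n^+}$, where $e_\alpha=e_{i_1}\otimes\cdots\otimes e_{i_k}$, $e_{g_0}=1$, and $e_1,\ldots,e_n$ is an orthonormal basis of $H_n$. A formal power series $\sum_\alpha c_\alpha Z_\alpha$ in noncommuting indeterminates $Z_1,\ldots,Z_n$ is a free holomorphic function in a neighborhood of the origin if there is $\rho>0$ such that $\sum_{k=0}^\infty\sum_{|\alpha|=k}c_\alpha X_\alpha$ converges in norm for every Hilbert space $\mathcal H$ and every $(X_1,\dots,X_n)\in B(\mathcal H)^n$ with $\|X_1X_1^*+\cdots+X_nX_n^*\|^{1/2}\le\rho$; equivalently $\limsup_k(\sum_{|\alpha|=k}|c_\alpha|^2)^{1/2k}<\infty$. $g=1+\sum_{|\alpha|\ge1}b_\alpha Z_\alpha$ is admissible if: (a) $b_{g_0}=1$, all $b_\alpha>0$, and $\sup_\alpha b_\alpha/b_{g_i\alpha}<\infty$ for each $i$; (b) $g$ is free holomorphic in a neighborhood of the origin; (c) $\sup_{k}\big\|\sum_{p=0}^k\sum_{|\alpha|=p}a_\alpha W_\alpha W_\alpha^*\big\|<\infty$, where $g^{-1}=1+\sum_{|\alpha|\ge1}a_\alpha Z_\alpha$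 is the inverse of $g$ as a power series ($a_{g_0}=1$) and $W_i\in B(F^2(H_n))$ are the weighted left creation operators $W_ie_\alpha=\sqrt{b_\alpha/b_{g_i\alpha}}\,e_{g_i\alpha}$. $\mathcal D_{g^{-1}}(\mathcal H)$ is the set of all $X\in B(\mathcal H)^n$ such that (i) $\Delta_{g^{-1}}(X,X^* ):=\sum_{p=0}^\infty\sum_{|\alpha|=p}a_\alpha X_\alpha X_\alpha^*$ converges in the weak operator topology and is $\ge0$; (ii) $\sum_{\alpha}b_\alpha X_\alpha\Delta_{g^{-1}}(X,X^* )X_\alpha^*\le I$, with convergence in the weak operator topology. $X\in\mathcal D_{g^{-1}}(\mathcal H)$ is pure if $\sum_\alpha b_\alpha X_\alpha\Delta_{g^{-1}}(X,X^* )X_\alpha^*=I$. For $T\in\mathcal D_{g^{-1}}(\mathcal H)$ the noncommutative Berezin kernel $K_{g,T}:\mathcal H\to F^2(H_n)\otimes\overline{\Delta_{g^{-1}}(T,T^* )\mathcal H}$ is $K_{g,T}h:=\sum_{\alpha}\sqrt{b_\alpha}\,e_\alpha\otimes\Delta_{g^{-1}}(T,T^* )^{1/2}T_\alpha^*h$. *)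

theory Defs
  imports "HOL-Analysis.Analysis"
begin

section \<open>Complex Hilbert spaces\<close>

text \<open>
  A complex Hilbert space is a complete real inner product space with a compatible complex
  structure; the real inner product is the real part of the complex one, which is linear in its
  \<^emph>\<open>first\<close> argument.
\<close>

class chilbert_space = real_inner + complete_space +
  fixes scaleC :: "complex \<Rightarrow> 'a \<Rightarrow> 'a"  (infixr \<open>*\<^sub>C\<close> 75)
    and cinner :: "'a \<Rightarrow> 'a \<Rightarrow> complex"
  assumes scaleC_add_right: "c *\<^sub>C (x + y) = c *\<^sub>C x + c *\<^sub>C y"
    and scaleC_add_left: "(c + d) *\<^sub>C x = c *\<^sub>C x + d *\<^sub>C x"
    and scaleC_scaleC: "c *\<^sub>C d *\<^sub>C x = (c * d) *\<^sub>C x"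
    and scaleC_of_real: "complex_of_real r *\<^sub>C x = r *\<^sub>R x"
    and cinner_commute: "cinner x y = cnj (cinner y x)"
    and cinner_add_left: "cinner (x + y) z = cinner x z + cinner y z"
    and cinner_scaleC_left: "cinner (c *\<^sub>C x) y = c * cinner x y"
    and inner_eq_Re_cinner: "inner x y = Re (cinner x y)"

lemma cinner_self: "cinner x x = complex_of_real ((norm x)\<^sup>2)" for x :: "'a::chilbert_space"
proof -
  have "Im (cinner x x) = 0"
    using arg_cong[OF cinner_commute[of x x], of Im] by simp
  then show ?thesis
    by (simp add: complex_eq_iff power2_norm_eq_inner inner_eq_Re_cinner)
qed

lemma norm_scaleC: "norm (c *\<^sub>C x) = cmod c * norm x" for x :: "'a::chilbert_space"
proof -
  have "cinner (c *\<^sub>C x) (c *\<^sub>C x) = c * cnj (c * cinner x x)"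
    by (metis cinner_commute cinner_scaleC_left)
  also have "\<dots> = complex_of_real ((cmod c * norm x)\<^sup>2)"
    by (simp add: cinner_self power_mult_distrib complex_norm_square[symmetric] mult.assoc[symmetric])
  finally have "(norm (c *\<^sub>C x))\<^sup>2 = (cmod c * norm x)\<^sup>2"
    by (simp only: cinner_self of_real_eq_iff)
  then show ?thesis
    by (simp add: power2_eq_iff_nonneg)
qed

lemma norm_cinner_le: "cmod (cinner x y) \<le> norm x * norm y" for x y :: "'a::chilbert_space"
proof -
  obtain c where c: "cmod c = 1" "c * cinner x y = complex_of_real (cmod (cinner x y))"
  proof (cases "cinner x y = 0")
    case True
    then show ?thesis using that[of 1] by simp
  next
    case False
    then show ?thesis
      using that[of "cnj (cinner x y) / complex_of_real (cmod (cinner x y))"]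
      by (simp add: norm_divide mult.commute[of "cnj _"] flip: complex_norm_square)
         (simp add: power2_eq_square)
  qed
  have "cmod (cinner x y) = inner (c *\<^sub>C x) y"
    by (simp add: inner_eq_Re_cinner cinner_scaleC_left c)
  also have "\<dots> \<le> norm (c *\<^sub>C x) * norm y"
    by (rule norm_cauchy_schwarz)
  finally show ?thesis by (simp add: norm_scaleC c)
qed

instantiation complex :: chilbert_space
begin

definition scaleC_complex :: "complex \<Rightarrow> complex \<Rightarrow> complex" where
  "scaleC_complex c z = c * z"

definition cinner_complex :: "complex \<Rightarrow> complex \<Rightarrow> complex" where
  "cinner_complex z w = z * cnj w"

instance
  by standard
     (simp_all add: scaleC_complex_def cinner_complex_def algebra_simps inner_complex_def
        scaleR_conv_of_real)

end

definition closed_csubspace :: "'a::chilbert_space set \<Rightarrow> bool" where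
  "closed_csubspace M \<longleftrightarrow> closed M \<and> 0 \<in> M \<and> (\<forall>x\<in>M. \<forall>y\<in>M. x + y \<in> M) \<and> (\<forall>c. \<forall>x\<in>M. c *\<^sub>C x \<in> M)"


section \<open>Bounded operators\<close>

definition bounded_clinear :: "('a::chilbert_space \<Rightarrow> 'b::chilbert_space) \<Rightarrow> bool" where
  "bounded_clinear A \<longleftrightarrow> bounded_linear A \<and> (\<forall>c x. A (c *\<^sub>C x) = c *\<^sub>C A x)"

definition cisometry :: "('a::chilbert_space \<Rightarrow> 'b::chilbert_space) \<Rightarrow> bool" where
  "cisometry V \<longleftrightarrow> bounded_clinear V \<and> (\<forall>x. norm (V x) = norm x)"

definition adj :: "('a::chilbert_space \<Rightarrow> 'b::chilbert_space) \<Rightarrow> 'b \<Rightarrow> 'a" where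
  "adj A = (THE B. bounded_clinear B \<and> (\<forall>x y. cinner (A x) y = cinner x (B y)))"

definition positive_op :: "('a::chilbert_space \<Rightarrow> 'a) \<Rightarrow> bool" where
  "positive_op A \<longleftrightarrow> bounded_clinear A \<and> (\<forall>x. cinner (A x) x \<in> \<real>\<^sub>\<ge>\<^sub>0)"

definition op_le :: "('a::chilbert_space \<Rightarrow> 'a) \<Rightarrow> ('a \<Rightarrow> 'a) \<Rightarrow> bool" where
  "op_le A B \<longleftrightarrow> positive_op (\<lambda>x. B x - A x)"

definition sqrt_op :: "('a::chilbert_space \<Rightarrow> 'a) \<Rightarrow> 'a \<Rightarrow> 'a" where
  "sqrt_op A = (THE R. positive_op R \<and> R \<circ> R = A)"

definition wot_sums :: "(nat \<Rightarrow> 'a::chilbert_space \<Rightarrow> 'a) \<Rightarrow> ('a \<Rightarrow> 'a) \<Rightarrow> bool" where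
  "wot_sums F S \<longleftrightarrow>
    bounded_clinear S \<and> (\<forall>x y. (\<lambda>p. cinner (F p x) y) sums cinner (S x) y)"

definition wot_has_sum :: "('i \<Rightarrow> 'a::chilbert_space \<Rightarrow> 'a) \<Rightarrow> ('a \<Rightarrow> 'a) \<Rightarrow> bool" where
  "wot_has_sum F S \<longleftrightarrow>
    bounded_clinear S \<and> (\<forall>x y. ((\<lambda>i. cinner (F i x) y) has_sum cinner (S x) y) UNIV)"


section \<open>Hilbert spaces of square-summable families\<close>

definition square_summable :: "('i \<Rightarrow> 'a::chilbert_space) \<Rightarrow> bool" where
  "square_summable f \<longleftrightarrow> (\<lambda>i. (norm (f i))\<^sup>2) summable_on UNIV"

lemma square_summable_zero: "square_summable (\<lambda>_. 0)"
  by (simp add: square_summable_def)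

lemma square_summable_scaleC:
  assumes "square_summable f"
  shows "square_summable (\<lambda>i. c *\<^sub>C f i)"
  using assms unfolding square_summable_def
  by (simp add: norm_scaleC power_mult_distrib summable_on_cmult_right)

lemma square_summable_add:
  assumes "square_summable f" "square_summable g"
  shows "square_summable (\<lambda>i. f i + g i)"
  unfolding square_summable_def
proof (rule summable_on_comparison_test)
  show "(\<lambda>i. 2 * (norm (f i))\<^sup>2 + 2 * (norm (g i))\<^sup>2) summable_on UNIV"
    using assms unfolding square_summable_def
    by (intro summable_on_add summable_on_cmult_right)
  show "(norm (f i + g i))\<^sup>2 \<le> 2 * (norm (f i))\<^sup>2 + 2 * (norm (g i))\<^sup>2" for i
  proof -
    have "(norm (f i + g i))\<^sup>2 \<le> (norm (f i) + norm (g i))\<^sup>2"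
      by (intro power_mono norm_triangle_ineq) simp
    also have "\<dots> \<le> 2 * (norm (f i))\<^sup>2 + 2 * (norm (g i))\<^sup>2"
      using zero_le_power2[of "norm (f i) - norm (g i)"]
      by (simp add: power2_eq_square algebra_simps)
    finally show ?thesis .
  qed
qed auto

typedef (overloaded) ('i, 'a) ell2 = "{f :: 'i \<Rightarrow> 'a::chilbert_space. square_summable f}"
  morphisms ell2_coord Abs_ell2
  using square_summable_zero by blast

setup_lifting type_definition_ell2

lemma square_summable_scaleR:
  assumes "square_summable f"
  shows "square_summable (\<lambda>i. r *\<^sub>R f i)"
  using square_summable_scaleC[OF assms, of "complex_of_real r"] by (simp add: scaleC_of_real)

lemma square_summable_cinner:
  assumes "square_summable f" "square_summable g"
  shows "(\<lambda>i. cinner (f i) (g i)) summable_on UNIV"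
proof (rule abs_summable_summable, rule summable_on_comparison_test)
  show "(\<lambda>i. (norm (f i))\<^sup>2 + (norm (g i))\<^sup>2) summable_on UNIV"
    using assms unfolding square_summable_def by (intro summable_on_add)
  show "cmod (cinner (f i) (g i)) \<le> (norm (f i))\<^sup>2 + (norm (g i))\<^sup>2" for i
  proof -
    have "norm (f i) * norm (g i) \<le> (norm (f i))\<^sup>2 + (norm (g i))\<^sup>2"
      using zero_le_power2[of "norm (f i) - norm (g i)"]
        mult_nonneg_nonneg[OF norm_ge_zero[of "f i"] norm_ge_zero[of "g i"]]
      unfolding power2_diff by linarith
    then show ?thesis
      using norm_cinner_le[of "f i" "g i"] by simp
  qed
qed simp_all

instantiation ell2 :: (type, chilbert_space) real_vector
begin

lift_definition zero_ell2 :: "('a, 'b) ell2" is "\<lambda>_. 0"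
  by (rule square_summable_zero)
lift_definition plus_ell2 :: "('a, 'b) ell2 \<Rightarrow> ('a, 'b) ell2 \<Rightarrow> ('a, 'b) ell2"
  is "\<lambda>f g i. f i + g i"
  by (rule square_summable_add)
lift_definition scaleR_ell2 :: "real \<Rightarrow> ('a, 'b) ell2 \<Rightarrow> ('a, 'b) ell2"
  is "\<lambda>r f i. r *\<^sub>R f i"
  by (rule square_summable_scaleR)
lift_definition uminus_ell2 :: "('a, 'b) ell2 \<Rightarrow> ('a, 'b) ell2" is "\<lambda>f i. - f i"
  by (simp add: square_summable_def)
lift_definition minus_ell2 :: "('a, 'b) ell2 \<Rightarrow> ('a, 'b) ell2 \<Rightarrow> ('a, 'b) ell2"
  is "\<lambda>f g i. f i - g i"
proof -
  fix f g :: "'a \<Rightarrow> 'b"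
  assume "square_summable f" "square_summable g"
  then show "square_summable (\<lambda>i. f i - g i)"
    using square_summable_add[of f "\<lambda>i. (-1) *\<^sub>R g i"] square_summable_scaleR[of g "-1"] by simp
qed

instance
  by standard (transfer; simp add: algebra_simps fun_eq_iff)+

end

instantiation ell2 :: (type, chilbert_space) real_inner
begin

lift_definition inner_ell2 :: "('a, 'b) ell2 \<Rightarrow> ('a, 'b) ell2 \<Rightarrow> real"
  is "\<lambda>f g. Re (infsum (\<lambda>i. cinner (f i) (g i)) UNIV)" .
definition norm_ell2 :: "('a, 'b) ell2 \<Rightarrow> real" where
  "norm_ell2 x = sqrt (inner x x)"
definition sgn_ell2 :: "('a, 'b) ell2 \<Rightarrow> ('a, 'b) ell2" where
  "sgn_ell2 x = x /\<^sub>R norm x"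
definition dist_ell2 :: "('a, 'b) ell2 \<Rightarrow> ('a, 'b) ell2 \<Rightarrow> real" where
  "dist_ell2 x y = norm (x - y)"
definition uniformity_ell2 :: "(('a, 'b) ell2 \<times> ('a, 'b) ell2) filter" where
  "uniformity_ell2 = (INF e\<in>{0<..}. principal {(x, y). dist x y < e})"
definition open_ell2 :: "('a, 'b) ell2 set \<Rightarrow> bool" where
  "open_ell2 U = (\<forall>x\<in>U. eventually (\<lambda>(x', y). x' = x \<longrightarrow> y \<in> U) uniformity)"

lemma inner_ell2_self: "inner x x = infsum (\<lambda>i. (norm (ell2_coord x i))\<^sup>2) UNIV"
  for x :: "('a, 'b) ell2"
  apply transfer
  apply (simp add: cinner_self)
  apply (subst infsum_Re[symmetric])
   apply (simp_all add: square_summable_def)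
  using summable_on_of_real by (metis (no_types, lifting) of_real_power summable_on_cong)

instance
proof
  fix x y z :: "('a, 'b) ell2" and r :: real
  show "dist x y = norm (x - y)" by (rule dist_ell2_def)
  show "sgn x = x /\<^sub>R norm x" by (rule sgn_ell2_def)
  show "uniformity = (INF e\<in>{0<..}. principal {(x, y). dist (x::('a,'b) ell2) y < e})"
    by (rule uniformity_ell2_def)
  show "open U = (\<forall>x\<in>U. eventually (\<lambda>(x', y). x' = x \<longrightarrow> y \<in> U) uniformity)"
    for U :: "('a, 'b) ell2 set"
    by (rule open_ell2_def)
  show "norm x = sqrt (inner x x)" by (rule norm_ell2_def)
  show "inner x y = inner y x"
    by transfer (subst cinner_commute, simp)
  show "inner (x + y) z = inner x z + inner y z"
    by transfer (simp add: cinner_add_left infsum_add square_summable_cinner)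
  show "inner (r *\<^sub>R x) y = r * inner x y"
    by transfer (simp add: cinner_scaleC_left infsum_cmult_right' flip: scaleC_of_real)
  show "0 \<le> inner x x"
    unfolding inner_ell2_self by (intro infsum_nonneg) simp
  show "inner x x = 0 \<longleftrightarrow> x = 0"
  proof
    assume *: "inner x x = 0"
    have "(norm (ell2_coord x i))\<^sup>2 = 0" for i
      using * ell2_coord[of x] unfolding inner_ell2_self
      by (intro nonneg_infsum_le_0D[where A=UNIV and f="\<lambda>i. (norm (ell2_coord x i))\<^sup>2"])
         (auto simp: square_summable_def)
    then show "x = 0" by transfer auto
  next
    assume "x = 0"
    then show "inner x x = 0" by (simp add: inner_ell2_self zero_ell2.rep_eq)
  qed
qed

end

lemma norm_ell2_power2: "(norm x)\<^sup>2 = infsum (\<lambda>i. (norm (ell2_coord x i))\<^sup>2) UNIV"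
  for x :: "('i, 'a::chilbert_space) ell2"
  by (simp add: power2_norm_eq_inner inner_ell2_self)

lemma sum_norm_ell2_coord_le: "finite F \<Longrightarrow> (\<Sum>i\<in>F. (norm (ell2_coord x i))\<^sup>2) \<le> (norm x)\<^sup>2"
  for x :: "('i, 'a::chilbert_space) ell2"
  unfolding norm_ell2_power2
  using ell2_coord[of x] by (intro finite_sum_le_infsum) (auto simp: square_summable_def)

lemma norm_ell2_coord_le: "norm (ell2_coord x i) \<le> norm x"
  for x :: "('i, 'a::chilbert_space) ell2"
  using sum_norm_ell2_coord_le[of "{i}" x] by (simp add: abs_le_square_iff[symmetric])

instance ell2 :: (type, chilbert_space) complete_space
proof
  fix X :: "nat \<Rightarrow> ('a, 'b) ell2"
  assume X: "Cauchy X"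
  have coord: "Cauchy (\<lambda>n. ell2_coord (X n) i)" for i
  proof (rule metric_CauchyI)
    fix e :: real assume "0 < e"
    then obtain N where "\<forall>m\<ge>N. \<forall>n\<ge>N. dist (X m) (X n) < e" using X by (auto simp: Cauchy_def)
    moreover have "dist (ell2_coord (X m) i) (ell2_coord (X n) i) \<le> dist (X m) (X n)" for m n
      using norm_ell2_coord_le[of "X m - X n" i] by (simp add: dist_norm minus_ell2.rep_eq)
    ultimately show "\<exists>N. \<forall>m\<ge>N. \<forall>n\<ge>N. dist (ell2_coord (X m) i) (ell2_coord (X n) i) < e"
      by (meson le_less_trans)
  qed
  then obtain f where f: "\<And>i. (\<lambda>n. ell2_coord (X n) i) \<longlonglongrightarrow> f i"
    using Cauchy_convergent[OF coord] unfolding convergent_def by metis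
  have bound: "(\<Sum>i\<in>F. (norm (f i - ell2_coord (X n) i))\<^sup>2) \<le> e\<^sup>2"
    if "finite F" "\<forall>m\<ge>N. dist (X m) (X n) < e" for F n N e
  proof (rule tendsto_upperbound)
    show "(\<lambda>m. \<Sum>i\<in>F. (norm (ell2_coord (X m) i - ell2_coord (X n) i))\<^sup>2)
        \<longlonglongrightarrow> (\<Sum>i\<in>F. (norm (f i - ell2_coord (X n) i))\<^sup>2)"
      by (intro tendsto_intros f)
    show "\<forall>\<^sub>F m in sequentially.
        (\<Sum>i\<in>F. (norm (ell2_coord (X m) i - ell2_coord (X n) i))\<^sup>2) \<le> e\<^sup>2"
    proof (rule eventually_sequentiallyI)
      fix m assume "N \<le> m"
      then have "norm (X m - X n) < e" using that by (simp add: dist_norm)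
      then have "(norm (X m - X n))\<^sup>2 \<le> e\<^sup>2" by (intro power_mono) auto
      then show "(\<Sum>i\<in>F. (norm (ell2_coord (X m) i - ell2_coord (X n) i))\<^sup>2) \<le> e\<^sup>2"
        using sum_norm_ell2_coord_le[OF \<open>finite F\<close>, of "X m - X n"]
        by (simp add: minus_ell2.rep_eq)
    qed
  qed simp
  have summ: "square_summable (\<lambda>i. f i - ell2_coord (X n) i)"
    if "\<forall>m\<ge>N. dist (X m) (X n) < e" for n N e
    unfolding square_summable_def
    by (rule nonneg_bdd_above_summable_on)
       (auto intro!: bdd_aboveI[where M="e\<^sup>2"] bound[OF _ that])
  have ss: "square_summable f"
  proof -
    obtain N where N: "\<forall>m\<ge>N. \<forall>n\<ge>N. dist (X m) (X n) < 1"
      using X by (meson Cauchy_def zero_less_one)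
    have "square_summable (\<lambda>i. f i - ell2_coord (X N) i)"
      using N by (intro summ[of N N 1]) auto
    then show ?thesis
      using square_summable_add[of "\<lambda>i. f i - ell2_coord (X N) i" "ell2_coord (X N)"]
        ell2_coord[of "X N"] by simp
  qed
  have L: "ell2_coord (Abs_ell2 f) = f"
    using ss by (simp add: Abs_ell2_inverse)
  have "X \<longlonglongrightarrow> Abs_ell2 f"
  proof (rule metric_LIMSEQ_I)
    fix r :: real assume "0 < r"
    then obtain N where N: "\<forall>m\<ge>N. \<forall>n\<ge>N. dist (X m) (X n) < r / 2"
      using X by (meson Cauchy_def half_gt_zero)
    have "dist (X n) (Abs_ell2 f) < r" if "n \<ge> N" for n
    proof -
      have *: "\<forall>m\<ge>N. dist (X m) (X n) < r / 2" using N that by simp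
      have "(norm (Abs_ell2 f - X n))\<^sup>2 \<le> (r / 2)\<^sup>2"
        unfolding norm_ell2_power2 minus_ell2.rep_eq L
        using summ[OF *] bound[OF _ *]
        by (intro infsum_le_finite_sums) (auto simp: square_summable_def)
      then have "norm (Abs_ell2 f - X n) \<le> r / 2"
        using \<open>0 < r\<close> by (simp add: abs_le_square_iff[symmetric])
      then show ?thesis using \<open>0 < r\<close> by (simp add: dist_norm norm_minus_commute)
    qed
    then show "\<exists>N. \<forall>n\<ge>N. dist (X n) (Abs_ell2 f) < r" by blast
  qed
  then show "convergent X" by (auto simp: convergent_def)
qed

instantiation ell2 :: (type, chilbert_space) chilbert_space
begin

lift_definition scaleC_ell2 :: "complex \<Rightarrow> ('a, 'b) ell2 \<Rightarrow> ('a, 'b) ell2"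
  is "\<lambda>c f i. c *\<^sub>C f i"
  by (rule square_summable_scaleC)
lift_definition cinner_ell2 :: "('a, 'b) ell2 \<Rightarrow> ('a, 'b) ell2 \<Rightarrow> complex"
  is "\<lambda>f g. infsum (\<lambda>i. cinner (f i) (g i)) UNIV" .

instance
proof
  fix x y z :: "('a, 'b) ell2" and c d :: complex and r :: real
  show "c *\<^sub>C (x + y) = c *\<^sub>C x + c *\<^sub>C y" by transfer (simp add: scaleC_add_right)
  show "(c + d) *\<^sub>C x = c *\<^sub>C x + d *\<^sub>C x" by transfer (simp add: scaleC_add_left)
  show "c *\<^sub>C d *\<^sub>C x = (c * d) *\<^sub>C x" by transfer (simp add: scaleC_scaleC)
  show "complex_of_real r *\<^sub>C x = r *\<^sub>R x" by transfer (simp add: scaleC_of_real)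
  show "cinner x y = cnj (cinner y x)"
    by transfer (subst cinner_commute, simp)
  show "cinner (x + y) z = cinner x z + cinner y z"
    by transfer (simp add: cinner_add_left infsum_add square_summable_cinner)
  show "cinner (c *\<^sub>C x) y = c * cinner x y"
    by transfer (simp add: cinner_scaleC_left infsum_cmult_right')
  show "inner x y = Re (cinner x y)"
    by transfer simp
qed

end


section \<open>The full Fock space and its tensor products\<close>

text \<open>
  The free semigroup on the generators indexed by the finite type \<^typ>\<open>'n\<close> is the type
  \<^typ>\<open>'n list\<close> of words: \<open>g\<^sub>0\<close> is \<open>[]\<close>, \<open>g\<^sub>i \<alpha>\<close> is \<open>i # \<alpha>\<close> and \<open>|\<alpha>|\<close> is \<open>length \<alpha>\<close>. The full
  Fock space is the Hilbert space with orthonormal basis indexed by the words.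
\<close>

type_synonym 'n fock = "('n list, complex) ell2"

lift_definition fock_basis :: "'n list \<Rightarrow> 'n fock" is "\<lambda>\<alpha> \<beta>. if \<beta> = \<alpha> then 1 else 0"
  unfolding square_summable_def
  by (rule summable_on_cong_neutral[THEN iffD1, OF _ _ _ summable_on_finite[of "{\<alpha>}" for \<alpha>]]) auto

text \<open>
  The Hilbert tensor product of \<^typ>\<open>'n fock\<close> with a Hilbert space \<^typ>\<open>'d\<close> is realised as
  \<^typ>\<open>('n list, 'd) ell2\<close> with elementary tensors \<open>(f \<otimes> d)(\<alpha>) = f(\<alpha>) d\<close>; the lemmas
  \<open>cinner_tensor\<close> and \<open>closure_span_tensor\<close> below are its characteristic properties.
\<close>

lift_definition tensor :: "('i, complex) ell2 \<Rightarrow> 'd \<Rightarrow> ('i, 'd::chilbert_space) ell2"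
  is "\<lambda>f d i. f i *\<^sub>C d"
  by (simp add: square_summable_def norm_scaleC power_mult_distrib summable_on_cmult_left)

text \<open>
  For a closed subspace \<open>D\<close> of \<^typ>\<open>'d\<close>, the subspace \<open>F\<^sup>2 \<otimes> D\<close>. The real span suffices, because
  the set of elementary tensors is closed under multiplication by complex scalars.
\<close>

definition fock_tensor :: "'d::chilbert_space set \<Rightarrow> ('n list, 'd) ell2 set" where
  "fock_tensor D = closure (span {tensor f d |f d. d \<in> D})"

text \<open>\<open>A \<otimes> I\<close> for a bounded operator \<open>A\<close> on the Fock space.\<close>

definition ampliation :: "('n fock \<Rightarrow> 'n fock) \<Rightarrow> ('n list, 'd::chilbert_space) ell2 \<Rightarrow> ('n list, 'd) ell2"
  where "ampliation A = (THE S. bounded_clinear S \<and> (\<forall>f d. S (tensor f d) = tensor (A f) d))"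

lemma cinner_fock_basis: "cinner (fock_basis \<alpha>) (fock_basis \<beta>) = (if \<alpha> = \<beta> then 1 else 0)"
proof -
  have "infsum (\<lambda>\<gamma>. cinner (if \<gamma> = \<alpha> then 1 else 0 :: complex) (if \<gamma> = \<beta> then 1 else 0)) UNIV
      = infsum (\<lambda>\<gamma>. if \<alpha> = \<beta> then 1 else 0) {\<alpha>}"
    by (rule infsum_cong_neutral) (auto simp: cinner_complex_def)
  then show ?thesis by transfer simp
qed

lemma cinner_tensor: "cinner (tensor f d) (tensor f' d') = cinner f f' * cinner d d'"
  for d d' :: "'b::chilbert_space"
proof -
  have eq: "cinner (a *\<^sub>C d) (b *\<^sub>C d') = cinner a b * cinner d d'"
    for a b :: complex and d d' :: 'b
  proof -
    have "cinner (a *\<^sub>C d) (b *\<^sub>C d') = a * cnj (b * cinner d' d)"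
      by (metis cinner_commute cinner_scaleC_left)
    also have "\<dots> = cinner a b * cinner d d'"
      using cinner_commute[of d d'] by (simp add: cinner_complex_def)
    finally show ?thesis .
  qed
  show ?thesis by transfer (simp add: eq infsum_cmult_left')
qed

lemma closure_span_tensor: "fock_tensor (UNIV :: 'd::chilbert_space set) = (UNIV :: ('n list, 'd) ell2 set)"
proof (intro set_eqI iffI UNIV_I)
  fix x :: "('n list, 'd) ell2"
  let ?f = "ell2_coord x"
  let ?g = "\<lambda>F. \<Sum>\<alpha>\<in>F. tensor (fock_basis \<alpha>) (?f \<alpha>)"
  have coord: "ell2_coord (?g F) \<beta> = (if \<beta> \<in> F then ?f \<beta> else 0)" if "finite F" for F \<beta>
  proof -
    have 1: "1 *\<^sub>C d = d" "0 *\<^sub>C d = 0" for d :: 'd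
      using scaleC_of_real[of 1 d] scaleC_of_real[of 0 d] by simp_all
    have "ell2_coord (?g F) \<beta> = (\<Sum>\<alpha>\<in>F. if \<beta> = \<alpha> then ?f \<alpha> else 0)"
      using that
      by (induction F) (auto simp: zero_ell2.rep_eq plus_ell2.rep_eq tensor.rep_eq fock_basis.rep_eq 1)
    then show ?thesis using that by simp
  qed
  show "x \<in> fock_tensor UNIV"
    unfolding fock_tensor_def closure_approachable
  proof (intro allI impI)
    fix e :: real assume "0 < e"
    have sm: "(\<lambda>\<alpha>. (norm (?f \<alpha>))\<^sup>2) summable_on UNIV"
      using ell2_coord[of x] by (simp add: square_summable_def)
    then have "((\<lambda>\<alpha>. (norm (?f \<alpha>))\<^sup>2) has_sum (norm x)\<^sup>2) UNIV"
      by (simp add: norm_ell2_power2)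
    then obtain F where F: "finite F" "dist (\<Sum>\<alpha>\<in>F. (norm (?f \<alpha>))\<^sup>2) ((norm x)\<^sup>2) < e\<^sup>2"
      using \<open>0 < e\<close> unfolding has_sum_def tendsto_iff eventually_finite_subsets_at_top
      by (meson subset_UNIV zero_less_power order_refl)
    have "(norm (x - ?g F))\<^sup>2 = infsum (\<lambda>\<alpha>. (norm (?f \<alpha>))\<^sup>2) (UNIV - F)"
      unfolding norm_ell2_power2 minus_ell2.rep_eq coord[OF F(1)]
      by (rule infsum_cong_neutral) auto
    also have "\<dots> = (norm x)\<^sup>2 - (\<Sum>\<alpha>\<in>F. (norm (?f \<alpha>))\<^sup>2)"
      unfolding norm_ell2_power2
      using F(1) by (subst infsum_Diff[OF sm]) auto
    also have "\<dots> < e\<^sup>2" using F(2) by (simp add: dist_real_def)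
    finally have "dist (?g F) x < e"
      using \<open>0 < e\<close> by (simp add: dist_norm norm_minus_commute power_less_imp_less_base)
    moreover have "?g F \<in> span {tensor f d |f d. d \<in> UNIV}"
      by (intro span_sum span_base) auto
    ultimately show "\<exists>y\<in>span {tensor f d |f d. d \<in> UNIV}. dist y x < e" by blast
  qed
qed


section \<open>Admissible free holomorphic functions\<close>

text \<open>
  A formal power series \<open>\<Sum>\<^sub>\<alpha> c\<^sub>\<alpha> Z\<^sub>\<alpha>\<close> is represented by its family of coefficients. The inverse is
  taken with respect to the Cauchy product.
\<close>

definition nc_one :: "'n list \<Rightarrow> 'c::comm_ring_1" where
  "nc_one \<alpha> = (if \<alpha> = [] then 1 else 0)"

definition nc_mult :: "('n list \<Rightarrow> 'c::comm_ring_1) \<Rightarrow> ('n list \<Rightarrow> 'c) \<Rightarrow> 'n list \<Rightarrow> 'c" where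
  "nc_mult c d \<alpha> = (\<Sum>(\<beta>, \<gamma>) | \<beta> @ \<gamma> = \<alpha>. c \<beta> * d \<gamma>)"

definition nc_inverse :: "('n list \<Rightarrow> 'c::comm_ring_1) \<Rightarrow> 'n list \<Rightarrow> 'c" where
  "nc_inverse c = (THE d. nc_mult c d = nc_one \<and> nc_mult d c = nc_one)"

text \<open>
  Free holomorphy near the origin is expressed by the Cauchy-Hadamard condition
  \<open>limsup\<^sub>k (\<Sum>\<^sub>|\<^sub>\<alpha>\<^sub>|\<^sub>=\<^sub>k |c\<^sub>\<alpha>|\<^sup>2)\<^sup>1\<^sup>/\<^sup>2\<^sup>k < \<infinity>\<close>. It is equivalent to norm convergence of \<open>\<Sum>\<^sub>k \<Sum>\<^sub>|\<^sub>\<alpha>\<^sub>|\<^sub>=\<^sub>k c\<^sub>\<alpha> X\<^sub>\<alpha>\<close>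
  on some row ball over \<^emph>\<open>all\<close> Hilbert spaces, a quantification over types that cannot be made
  inside a definition.
\<close>

definition free_holomorphic_near_0 :: "('n::finite list \<Rightarrow> complex) \<Rightarrow> bool" where
  "free_holomorphic_near_0 c \<longleftrightarrow>
    limsup (\<lambda>k. ereal ((\<Sum>\<alpha> | length \<alpha> = k. (cmod (c \<alpha>))\<^sup>2) powr (1 / (2 * real k)))) < \<infinity>"

fun word_op :: "('n \<Rightarrow> 'a \<Rightarrow> 'a) \<Rightarrow> 'n list \<Rightarrow> 'a \<Rightarrow> 'a" where
  "word_op X [] = id"
| "word_op X (i # \<alpha>) = X i \<circ> word_op X \<alpha>"

definition weighted_creation :: "('n list \<Rightarrow> real) \<Rightarrow> 'n \<Rightarrow> 'n fock \<Rightarrow> 'n fock" where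
  "weighted_creation b i = (THE W. bounded_clinear W \<and>
    (\<forall>\<alpha>. W (fock_basis \<alpha>) = sqrt (b \<alpha> / b (i # \<alpha>)) *\<^sub>R fock_basis (i # \<alpha>)))"

text \<open>
  All coefficients of an admissible function are positive, so it is given by the real family \<open>b\<close>,
  and the coefficients of its inverse are real as well.
\<close>

definition admissible :: "('n::finite list \<Rightarrow> real) \<Rightarrow> bool" where
  "admissible b \<longleftrightarrow>
    b [] = 1 \<and> (\<forall>\<alpha>. 0 < b \<alpha>) \<and> (\<forall>i. bdd_above (range (\<lambda>\<alpha>. b \<alpha> / b (i # \<alpha>)))) \<and>
    free_holomorphic_near_0 (\<lambda>\<alpha>. complex_of_real (b \<alpha>)) \<and>
    bdd_above (range (\<lambda>k. onorm (\<lambda>x. \<Sum>p\<le>k. \<Sum>\<alpha> | length \<alpha> = p.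
      nc_inverse b \<alpha> *\<^sub>R word_op (weighted_creation b) \<alpha> (adj (word_op (weighted_creation b) \<alpha>) x))))"


section \<open>The noncommutative domain and the Berezin kernel\<close>

definition defect_sums :: "('n::finite list \<Rightarrow> real) \<Rightarrow> ('n \<Rightarrow> 'h::chilbert_space \<Rightarrow> 'h) \<Rightarrow> ('h \<Rightarrow> 'h) \<Rightarrow> bool"
  where "defect_sums b X \<Delta> \<longleftrightarrow> wot_sums
    (\<lambda>p x. \<Sum>\<alpha> | length \<alpha> = p. nc_inverse b \<alpha> *\<^sub>R word_op X \<alpha> (adj (word_op X \<alpha>) x)) \<Delta>"

definition defect :: "('n::finite list \<Rightarrow> real) \<Rightarrow> ('n \<Rightarrow> 'h::chilbert_space \<Rightarrow> 'h) \<Rightarrow> 'h \<Rightarrow> 'h" where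
  "defect b X = (THE \<Delta>. defect_sums b X \<Delta>)"

definition berezin_sums :: "('n::finite list \<Rightarrow> real) \<Rightarrow> ('n \<Rightarrow> 'h::chilbert_space \<Rightarrow> 'h) \<Rightarrow> ('h \<Rightarrow> 'h) \<Rightarrow> bool"
  where "berezin_sums b X S \<longleftrightarrow> wot_has_sum
    (\<lambda>\<alpha> x. b \<alpha> *\<^sub>R word_op X \<alpha> (defect b X (adj (word_op X \<alpha>) x))) S"

definition nc_domain :: "('n::finite list \<Rightarrow> real) \<Rightarrow> ('n \<Rightarrow> 'h::chilbert_space \<Rightarrow> 'h) set" where
  "nc_domain b = {X. (\<forall>i. bounded_clinear (X i)) \<and>
    (\<exists>\<Delta>. defect_sums b X \<Delta> \<and> positive_op \<Delta>) \<and>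
    (\<exists>S. berezin_sums b X S \<and> op_le S id)}"

definition pure_tuple :: "('n::finite list \<Rightarrow> real) \<Rightarrow> ('n \<Rightarrow> 'h::chilbert_space \<Rightarrow> 'h) \<Rightarrow> bool" where
  "pure_tuple b X \<longleftrightarrow> X \<in> nc_domain b \<and> berezin_sums b X id"

definition defect_space :: "('n::finite list \<Rightarrow> real) \<Rightarrow> ('n \<Rightarrow> 'h::chilbert_space \<Rightarrow> 'h) \<Rightarrow> 'h set" where
  "defect_space b X = closure (range (defect b X))"

text \<open>The series defining the Berezin kernel is summed in the norm of the tensor product.\<close>

definition berezin_kernel ::
    "('n::finite list \<Rightarrow> real) \<Rightarrow> ('n \<Rightarrow> 'h::chilbert_space \<Rightarrow> 'h) \<Rightarrow> 'h \<Rightarrow> ('n list, 'h) ell2" where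
  "berezin_kernel b T h =
    (\<Sum>\<^sub>\<infinity>\<alpha>. sqrt (b \<alpha>) *\<^sub>R tensor (fock_basis \<alpha>) (sqrt_op (defect b T) (adj (word_op T \<alpha>) h)))"

text \<open>
  \<open>T\<^sub>i\<^sup>* = (W\<^sub>i\<^sup>* \<otimes> I\<^sub>D)|\<^sub>H\<close> for a Hilbert space \<open>D\<close>, given as a closed subspace of an ambient Hilbert space
  \<^typ>\<open>'d\<close>, where \<open>H\<close> is identified, via the isometry \<open>V\<close>, with the subspace \<open>range V\<close> of \<open>F\<^sup>2 \<otimes> D\<close>,
  which is coinvariant, i.e. invariant under the adjoints \<open>(W\<^sub>i \<otimes> I\<^sub>D)\<^sup>*\<close>. The operators \<open>A \<otimes> I\<^sub>D\<close> are the
  restrictions of \<open>A \<otimes> I\<close> to the reducing subspace \<open>F\<^sup>2 \<otimes> D\<close>.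
\<close>

definition has_coinvariant_model ::
    "('n::finite list \<Rightarrow> real) \<Rightarrow> ('n \<Rightarrow> 'h::chilbert_space \<Rightarrow> 'h) \<Rightarrow> 'd::chilbert_space set \<Rightarrow> bool" where
  "has_coinvariant_model b T D \<longleftrightarrow> closed_csubspace D \<and>
    (\<exists>V :: 'h \<Rightarrow> ('n list, 'd) ell2. cisometry V \<and> range V \<subseteq> fock_tensor D \<and>
      (\<forall>i. adj (ampliation (weighted_creation b i)) ` range V \<subseteq> range V) \<and>
      (\<forall>i h. V (adj (T i) h) = ampliation (adj (weighted_creation b i)) (V h)))"

end

theory Submission
  imports Defs
begin

text \<open>
  An intertwining isometry \<open>V\<close> carries \<open>T\<^sub>\<alpha> T\<^sub>\<alpha>\<^sup>*\<close> to \<open>(W\<^sub>\<alpha> W\<^sub>\<alpha>\<^sup>*) \<otimes> I\<close>, which is diagonal in the basis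
  \<open>e\<^sub>\<gamma>\<close>. Since \<open>g\<^sup>-\<^sup>1 g = 1\<close>, the partial sums of the defect of \<open>W\<close> have diagonal entries that are
  eventually \<open>1\<close> at the vacuum and \<open>0\<close> elsewhere; admissibility bounds them uniformly, so by dominated
  convergence the defect of \<open>T\<close> is the compression of the vacuum projection,
  \<open>\<langle>\<Delta>x, y\<rangle> = \<langle>(Vx)\<^sub>0, (Vy)\<^sub>0\<rangle>\<close>. Then \<open>b\<^sub>\<alpha> \<langle>\<Delta>T\<^sub>\<alpha>\<^sup>*x, T\<^sub>\<alpha>\<^sup>*y\<rangle> = \<langle>(Vx)\<^sub>\<alpha>, (Vy)\<^sub>\<alpha>\<rangle>\<close>, and summing over
  \<open>\<alpha>\<close> shows that \<open>T\<close> is pure. Conversely, for pure \<open>T\<close> the Berezin kernel has coordinates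
  \<open>\<surd>b\<^sub>\<alpha> \<Delta>\<^sup>1\<^sup>/\<^sup>2 T\<^sub>\<alpha>\<^sup>* h\<close>; purity says exactly that it is isometric, and the intertwining relation is a
  comparison of coordinates. The square root \<open>\<Delta>\<^sup>1\<^sup>/\<^sup>2\<close> is obtained from the binomial series of
  \<open>sqrt (1 - t)\<close>, whose coefficients are absolutely summable.
\<close>

section \<open>Orthogonal projections in Hilbert spaces\<close>

text \<open>Completeness is part of the class; in a \<open>banach\<close> type absolutely summable
  families are summable, which the square root series below relies on.\<close>

instance chilbert_space \<subseteq> banach ..

lemma scaleC_one [simp]: "1 *\<^sub>C x = x" for x :: "'a::chilbert_space"
  using scaleC_of_real[of 1 x] by simp

lemma scaleC_zero_left [simp]: "0 *\<^sub>C x = 0" for x :: "'a::chilbert_space"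
  using scaleC_of_real[of 0 x] by simp

lemma scaleC_zero_right [simp]: "c *\<^sub>C (0::'a::chilbert_space) = 0"
  using scaleC_add_right[of c 0 "0::'a"] by simp

lemma scaleC_minus_right: "c *\<^sub>C (- x) = - (c *\<^sub>C x)" for x :: "'a::chilbert_space"
  using scaleC_add_right[of c x "- x"] by (simp add: eq_neg_iff_add_eq_0 add.commute)

lemma scaleC_diff_right: "c *\<^sub>C (x - y) = c *\<^sub>C x - c *\<^sub>C y" for x y :: "'a::chilbert_space"
  using scaleC_add_right[of c x "- y"] by (simp add: scaleC_minus_right)

lemma scaleC_scaleR: "c *\<^sub>C r *\<^sub>R x = r *\<^sub>R c *\<^sub>C x" for x :: "'a::chilbert_space"
  by (metis scaleC_of_real scaleC_scaleC mult.commute)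

lemma bounded_linear_scaleC: "bounded_linear (\<lambda>x::'a::chilbert_space. c *\<^sub>C x)"
  by (rule bounded_linear_intro[where K = "cmod c"])
    (auto simp: scaleC_add_right scaleC_scaleR norm_scaleC)

lemma cinner_add_right: "cinner x (y + z) = cinner x y + cinner x z" for x y z :: "'a::chilbert_space"
  by (metis cinner_commute cinner_add_left complex_cnj_add)

lemma cinner_scaleC_right: "cinner x (c *\<^sub>C y) = cnj c * cinner x y" for x y :: "'a::chilbert_space"
  by (metis cinner_commute cinner_scaleC_left complex_cnj_mult)

lemma cinner_scaleR_left: "cinner (r *\<^sub>R x) y = of_real r * cinner x y" for x y :: "'a::chilbert_space"
  by (metis cinner_scaleC_left scaleC_of_real)

lemma cinner_scaleR_right: "cinner x (r *\<^sub>R y) = of_real r * cinner x y" for x y :: "'a::chilbert_space"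
  by (metis cinner_scaleC_right scaleC_of_real complex_cnj_complex_of_real)

lemma bounded_linear_cinner_left: "bounded_linear (\<lambda>x. cinner x y)" for y :: "'a::chilbert_space"
  by (rule bounded_linear_intro[where K = "norm y"])
    (auto simp: cinner_add_left cinner_scaleR_left scaleR_conv_of_real norm_cinner_le)

lemma bounded_linear_cinner_right: "bounded_linear (\<lambda>y. cinner x y)" for x :: "'a::chilbert_space"
  by (rule bounded_linear_intro[where K = "norm x"])
    (auto simp: cinner_add_right cinner_scaleR_right scaleR_conv_of_real norm_cinner_le
      simp: mult.commute[of _ "norm x"])

lemmas cinner_zero_left [simp] = linear_0[OF bounded_linear.linear[OF bounded_linear_cinner_left]]
  and cinner_zero_right [simp] = linear_0[OF bounded_linear.linear[OF bounded_linear_cinner_right]]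
  and cinner_diff_left = linear_diff[OF bounded_linear.linear[OF bounded_linear_cinner_left]]
  and cinner_diff_right = linear_diff[OF bounded_linear.linear[OF bounded_linear_cinner_right]]
  and cinner_sum_left = linear_sum[OF bounded_linear.linear[OF bounded_linear_cinner_left]]

lemma cinner_eq_zero_iff [simp]: "cinner x x = 0 \<longleftrightarrow> x = 0" for x :: "'a::chilbert_space"
  by (simp add: cinner_self)

lemma cinner_ext: "x = y" if "\<And>z. cinner x z = cinner y z" for x y :: "'a::chilbert_space"
  using that[of "x - y"] cinner_eq_zero_iff[of "x - y"] by (simp add: cinner_diff_left)

lemma cinner_ext_right: "x = y" if "\<And>z. cinner z x = cinner z y" for x y :: "'a::chilbert_space"
  by (rule cinner_ext) (metis that cinner_commute)

text \<open>Pairing with \<open>\<i> *\<^sub>C y\<close> recovers the imaginary part of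
  \<open>cinner x y\<close>, so real orthogonality to a complex subspace is complex
  orthogonality.\<close>

lemma cinner_eq_0_if_inner_eq_0:
  fixes x :: "'a::chilbert_space"
  assumes "inner x y = 0" "inner x (\<i> *\<^sub>C y) = 0"
  shows "cinner x y = 0"
  using assms by (simp add: inner_eq_Re_cinner cinner_scaleC_right complex_eq_iff)

section \<open>Nearest points and orthogonality\<close>

lemma closed_csubspace_scaleR:
  "closed_csubspace M \<Longrightarrow> x \<in> M \<Longrightarrow> r *\<^sub>R x \<in> M"
  unfolding closed_csubspace_def by (metis scaleC_of_real)

lemma closed_csubspace_imp_subspace: "closed_csubspace M \<Longrightarrow> subspace M"
  by (auto simp: subspace_def closed_csubspace_scaleR) (auto simp: closed_csubspace_def)

text \<open>If the inner product were nonzero, moving \<open>m\<close> along \<open>y\<close> by the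
  minimizer \<open>t\<close> of the quadratic norm (x - m - t y)^2 would bring it strictly closer to
  \<open>x\<close>.\<close>

lemma orthogonal_if_closest:
  fixes x :: "'a::real_inner"
  assumes M: "subspace M" and m: "m \<in> M" and min: "\<And>y. y \<in> M \<Longrightarrow> norm (x - m) \<le> norm (x - y)"
    and y: "y \<in> M"
  shows "inner (x - m) y = 0"
proof (rule ccontr)
  assume *: "inner (x - m) y \<noteq> 0"
  define t where "t = inner (x - m) y / inner y y"
  from * have y0: "inner y y > 0" by auto
  have "norm (x - m) \<le> norm (x - (m + t *\<^sub>R y))"
    using M m y by (intro min) (simp add: subspace_def)
  then have "inner (x - m) (x - m) \<le> inner (x - m - t *\<^sub>R y) (x - m - t *\<^sub>R y)"
    by (simp add: norm_le diff_diff_eq)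
  also have "\<dots> = inner (x - m) (x - m) - 2 * t * inner (x - m) y + t * t * inner y y"
    by (simp add: inner_diff_left inner_diff_right inner_commute algebra_simps)
  finally have "2 * t * inner (x - m) y \<le> t * t * inner y y" by simp
  then show False
    using y0 * by (auto simp: t_def field_simps) (smt (verit) mult_less_0_iff zero_less_mult_iff)
qed

text \<open>A minimizing sequence is Cauchy by the parallelogram identity; its limit stays in
  \<open>M\<close> because \<open>M\<close> is closed.\<close>

lemma closest_point_exists_closed_subspace:
  fixes M :: "'a::{real_inner, complete_space} set"
  assumes M: "subspace M" and cl: "closed M"
  obtains m where "m \<in> M" "\<And>y. y \<in> M \<Longrightarrow> norm (x - m) \<le> norm (x - y)"
proof -
  define d where "d = infdist x M"
  have ne: "M \<noteq> {}" using M subspace_0 by blast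
  have d: "d \<le> norm (x - y)" if "y \<in> M" for y
    using infdist_le[OF that, of x] by (simp add: d_def dist_norm)
  have d0: "0 \<le> d" by (simp add: d_def infdist_nonneg)
  have "\<exists>y\<in>M. norm (x - y) < d + 1 / real (Suc n)" for n
  proof -
    have "Inf ((dist x) ` M) < d + 1 / real (Suc n)"
      using ne by (simp add: d_def infdist_def)
    then show ?thesis
      using cInf_lessD[of "dist x ` M"] ne by (auto simp: dist_norm)
  qed
  then obtain m where m: "\<And>n. m n \<in> M" "\<And>n. norm (x - m n) < d + 1 / real (Suc n)"
    by metis
  \<comment> \<open>The midpoint of \<open>m k\<close> and \<open>m l\<close> lies in
    \<open>M\<close>, hence has distance at least \<open>d\<close> from \<open>x\<close>; this
    bounds the other diagonal of the parallelogram.\<close>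
  have par: "(norm (m k - m l))\<^sup>2 \<le> 2 * ((norm (x - m k))\<^sup>2 - d\<^sup>2) + 2 * ((norm (x - m l))\<^sup>2 - d\<^sup>2)" for k l
  proof -
    have "(1/2) *\<^sub>R (m k + m l) \<in> M"
      using M m(1) by (simp add: subspace_def)
    then have "d\<^sup>2 \<le> (norm (x - (1/2) *\<^sub>R (m k + m l)))\<^sup>2"
      using d d0 by (intro power_mono) auto
    also have "x - (1/2) *\<^sub>R (m k + m l) = (1/2) *\<^sub>R ((x - m k) + (x - m l))"
      by (simp add: algebra_simps flip: scaleR_add_left)
    also have "(norm \<dots>)\<^sup>2 = (norm ((x - m k) + (x - m l)))\<^sup>2 / 4"
      by (simp add: power_divide)
    finally have "4 * d\<^sup>2 \<le> (norm ((x - m k) + (x - m l)))\<^sup>2" by simp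
    moreover have "(norm ((x - m k) + (x - m l)))\<^sup>2 + (norm ((x - m k) - (x - m l)))\<^sup>2
        = 2 * (norm (x - m k))\<^sup>2 + 2 * (norm (x - m l))\<^sup>2"
      by (simp add: power2_norm_eq_inner inner_add_left inner_add_right inner_diff_left
          inner_diff_right inner_commute)
    moreover have "norm ((x - m k) - (x - m l)) = norm (m k - m l)"
      by (simp add: norm_minus_commute)
    ultimately show ?thesis by simp
  qed
  \<comment> \<open>An explicit rate, from which the threshold \<open>N\<close> of the Cauchy
    estimate is read off.\<close>
  have bnd: "(norm (x - m n))\<^sup>2 - d\<^sup>2 \<le> (2 * d + 1) / real (Suc n)" for n
  proof -
    have "(norm (x - m n))\<^sup>2 \<le> (d + 1 / real (Suc n))\<^sup>2"
      using m(2)[of n] by (intro power_mono) auto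
    also have "\<dots> = d\<^sup>2 + 2 * d / real (Suc n) + 1 / real (Suc n) * (1 / real (Suc n))"
      unfolding power2_sum by (simp add: power2_eq_square)
    also have "1 / real (Suc n) * (1 / real (Suc n)) \<le> 1 / real (Suc n) * 1"
      by (intro mult_left_mono) auto
    finally show ?thesis by (simp add: add_divide_distrib)
  qed
  have "Cauchy m"
  proof (rule metric_CauchyI)
    fix e :: real assume e: "0 < e"
    obtain N where N: "4 * (2 * d + 1) / e\<^sup>2 < real N" using reals_Archimedean2 by blast
    have small: "(2 * d + 1) / real (Suc k) < e\<^sup>2 / 4" if "k \<ge> N" for k
    proof -
      have "4 * (2 * d + 1) / e\<^sup>2 < real (Suc k)" using N that by simp
      then show ?thesis using e by (simp add: field_simps)
    qed
    have "dist (m k) (m l) < e" if "k \<ge> N" "l \<ge> N" for k l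
    proof -
      have "(norm (m k - m l))\<^sup>2 < 2 * (e\<^sup>2 / 4) + 2 * (e\<^sup>2 / 4)"
        using that by (intro le_less_trans[OF par] add_strict_mono mult_strict_left_mono
            le_less_trans[OF bnd small]) auto
      then have "(norm (m k - m l))\<^sup>2 < e\<^sup>2" by simp
      then show ?thesis using e by (simp add: dist_norm power_less_imp_less_base)
    qed
    then show "\<exists>N. \<forall>k\<ge>N. \<forall>l\<ge>N. dist (m k) (m l) < e" by blast
  qed
  then obtain l where l: "m \<longlonglongrightarrow> l"
    using Cauchy_convergent convergent_def by blast
  have "l \<in> M" using closed_sequentially[OF cl] m(1) l by blast
  moreover have "norm (x - l) \<le> d"
  proof (rule LIMSEQ_le)
    show "(\<lambda>n. norm (x - m n)) \<longlonglongrightarrow> norm (x - l)" by (intro tendsto_intros l)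
    show "(\<lambda>n. d + 1 / real (Suc n)) \<longlonglongrightarrow> d"
      using LIMSEQ_inverse_real_of_nat_add[of d] by (simp add: inverse_eq_divide)
    show "\<exists>N. \<forall>n\<ge>N. norm (x - m n) \<le> d + 1 / real (Suc n)"
      using m(2) less_imp_le by blast
  qed
  ultimately show ?thesis using that d order_trans by blast
qed

lemma closed_csubspace_projection:
  assumes M: "closed_csubspace M"
  obtains m where "m \<in> M" "\<And>y. y \<in> M \<Longrightarrow> cinner (x - m) y = 0"
proof -
  have S: "subspace M" by (rule closed_csubspace_imp_subspace[OF M])
  obtain m where m: "m \<in> M" "\<And>y. y \<in> M \<Longrightarrow> norm (x - m) \<le> norm (x - y)"
    using closest_point_exists_closed_subspace[OF S] M unfolding closed_csubspace_def by metis
  have "cinner (x - m) y = 0" if "y \<in> M" for y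
    using that M by (intro cinner_eq_0_if_inner_eq_0 orthogonal_if_closest[OF S m])
      (auto simp: closed_csubspace_def)
  with m(1) that show ?thesis by blast
qed

section \<open>Bounded operators and adjoints\<close>

lemma bounded_clinear_imp_bounded_linear: "bounded_clinear A \<Longrightarrow> bounded_linear A"
  by (simp add: bounded_clinear_def)

lemma bounded_clinear_imp_linear: "bounded_clinear A \<Longrightarrow> linear A"
  by (simp add: bounded_clinear_def bounded_linear.linear)

lemma bounded_clinear_scaleC: "bounded_clinear A \<Longrightarrow> A (c *\<^sub>C x) = c *\<^sub>C A x"
  by (simp add: bounded_clinear_def)

lemmas bounded_clinear_add = linear_add[OF bounded_clinear_imp_linear]
  and bounded_clinear_diff = linear_diff[OF bounded_clinear_imp_linear]
  and bounded_clinear_zero = linear_0[OF bounded_clinear_imp_linear]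
  and bounded_clinear_scaleR = linear_scale[OF bounded_clinear_imp_linear]

lemma bounded_clinear_intro:
  assumes "\<And>x y. A (x + y) = A x + A y" "\<And>c x. A (c *\<^sub>C x) = c *\<^sub>C A x"
    "\<And>x. norm (A x) \<le> norm x * K"
  shows "bounded_clinear A"
  unfolding bounded_clinear_def
  by (metis assms bounded_linear_intro scaleC_of_real)

lemma bounded_clinear_id: "bounded_clinear id"
  by (rule bounded_clinear_intro[where K = 1]) auto

lemma bounded_clinear_compose: "bounded_clinear A \<Longrightarrow> bounded_clinear B \<Longrightarrow> bounded_clinear (A \<circ> B)"
  by (auto simp: bounded_clinear_def o_def intro: bounded_linear_compose)

lemma bounded_clinear_diff_op:
  "bounded_clinear A \<Longrightarrow> bounded_clinear B \<Longrightarrow> bounded_clinear (\<lambda>x. A x - B x)"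
  by (auto simp: bounded_clinear_def scaleC_diff_right intro: bounded_linear_sub)

lemma bounded_clinear_scaleR_op: "bounded_clinear A \<Longrightarrow> bounded_clinear (\<lambda>x. r *\<^sub>R A x)"
  by (auto simp: bounded_clinear_def scaleC_scaleR
      intro: bounded_linear_compose[OF bounded_linear_scaleR_right])

lemma bounded_clinear_const_zero: "bounded_clinear (\<lambda>_. 0)"
  by (rule bounded_clinear_intro[where K = 1]) auto

lemma bounded_clinear_add_op:
  "bounded_clinear A \<Longrightarrow> bounded_clinear B \<Longrightarrow> bounded_clinear (\<lambda>x. A x + B x)"
  by (auto simp: bounded_clinear_def scaleC_add_right intro: bounded_linear_add)

lemma bounded_clinear_sum_op:
  "(\<And>i. i \<in> I \<Longrightarrow> bounded_clinear (A i)) \<Longrightarrow> bounded_clinear (\<lambda>x. \<Sum>i\<in>I. A i x)"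
  by (induction I rule: infinite_finite_induct)
    (auto intro: bounded_clinear_const_zero bounded_clinear_add_op)

text \<open>Off the trivial case, the representing vector is a multiple of a vector \<open>n\<close>
  orthogonal to the kernel of \<open>f\<close>, obtained by projecting some \<open>x\<close> with
  nonzero value.\<close>

lemma riesz_representation:
  fixes f :: "'a::chilbert_space \<Rightarrow> complex"
  assumes f: "bounded_linear f" and fC: "\<And>c x. f (c *\<^sub>C x) = c * f x"
  obtains v where "\<And>x. f x = cinner x v"
proof (cases "\<forall>x. f x = 0")
  case True
  then show ?thesis using that[of 0] by simp
next
  case False
  then obtain x where x: "f x \<noteq> 0" by blast
  interpret bounded_linear f by (rule f)
  have "closed {y. f y = 0}"
    by (intro closed_Collect_eq continuous_intros continuous_on)
  then have "closed_csubspace {y. f y = 0}"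
    by (auto simp: closed_csubspace_def add zero fC)
  then obtain m where m: "f m = 0" "\<And>y. f y = 0 \<Longrightarrow> cinner (x - m) y = 0"
    using closed_csubspace_projection[of "{y. f y = 0}" x] by auto
  define n where "n = x - m"
  have fn: "f n = f x" by (simp add: n_def diff m)
  then have n0: "n \<noteq> 0" using x zero by metis
  \<comment> \<open>Subtracting the right multiple of \<open>n\<close> moves \<open>y\<close> into
    the kernel, so the difference is orthogonal to \<open>n\<close>. The conjugate compensates for
    conjugate-linearity in the second argument.\<close>
  have "f y = cinner y ((cnj (f n) / cinner n n) *\<^sub>C n)" for y
  proof -
    have "f (y - (f y / f n) *\<^sub>C n) = 0" using x fn by (simp add: diff fC)
    then have "cinner n (y - (f y / f n) *\<^sub>C n) = 0" using m(2) by (simp add: n_def)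
    then have "cinner (y - (f y / f n) *\<^sub>C n) n = 0" by (subst cinner_commute) simp
    then have "cinner y n = (f y / f n) * cinner n n"
      by (simp add: cinner_diff_left cinner_scaleC_left)
    then show ?thesis using x fn n0
      by (simp add: cinner_scaleC_right cinner_commute[of n n, symmetric])
  qed
  then show ?thesis by (rule that)
qed

text \<open>Riesz gives \<open>B y\<close> for each \<open>y\<close> separately; linearity and
  boundedness of \<open>B\<close> then follow from the defining relation.\<close>

lemma adj_exists:
  assumes A: "bounded_clinear A"
  shows "\<exists>B. bounded_clinear B \<and> (\<forall>x y. cinner (A x) y = cinner x (B y))"
proof -
  have "\<exists>v. \<forall>x. cinner (A x) y = cinner x v" for y
  proof -
    have "bounded_linear (\<lambda>x. cinner (A x) y)"
      using A by (intro bounded_linear_compose[OF bounded_linear_cinner_left])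
        (simp add: bounded_clinear_def)
    then show ?thesis
      by (rule riesz_representation[of "\<lambda>x. cinner (A x) y"])
        (auto simp: bounded_clinear_scaleC[OF A] cinner_scaleC_left)
  qed
  then obtain B where B: "\<And>x y. cinner (A x) y = cinner x (B y)" by metis
  obtain K where K: "\<And>x. norm (A x) \<le> norm x * K" "K > 0"
    using bounded_linear.pos_bounded[of A] A by (auto simp: bounded_clinear_def)
  have "bounded_clinear B"
  proof (rule bounded_clinear_intro[where K = K])
    show "B (x + y) = B x + B y" for x y
      by (rule cinner_ext_right) (simp add: cinner_add_right flip: B)
    show "B (c *\<^sub>C x) = c *\<^sub>C B x" for c x
      by (rule cinner_ext_right) (simp add: cinner_scaleC_right flip: B)
    show "norm (B y) \<le> norm y * K" for y
    proof (cases "B y = 0")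
      case True then show ?thesis using K by simp
    next
      case False
      \<comment> \<open>The relation is tested at \<open>x = B y\<close>, so that the bound
        \<open>K\<close> of \<open>A\<close> passes to \<open>B\<close>.\<close>
      have "norm (B y) * norm (B y) = cmod (cinner (A (B y)) y)"
        by (simp only: B cinner_self norm_of_real) (simp add: power2_eq_square)
      also have "\<dots> \<le> norm (A (B y)) * norm y" by (rule norm_cinner_le)
      also have "\<dots> \<le> norm (B y) * K * norm y" by (intro mult_right_mono K) auto
      finally have "norm (B y) * norm (B y) \<le> norm (B y) * (norm y * K)" by (simp add: mult_ac)
      then show ?thesis using False by simp
    qed
  qed
  with B show ?thesis by blast
qed

lemma adj_unique:
  assumes "bounded_clinear B" "\<And>x y. cinner (A x) y = cinner x (B y)"
  shows "adj A = B"
  unfolding adj_def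
proof (rule the_equality)
  show "bounded_clinear B \<and> (\<forall>x y. cinner (A x) y = cinner x (B y))" using assms by blast
  fix C assume "bounded_clinear C \<and> (\<forall>x y. cinner (A x) y = cinner x (C y))"
  then have "cinner x (C y) = cinner x (B y)" for x y using assms(2) by metis
  then show "C = B" by (rule ext[OF cinner_ext_right])
qed

lemma adj:
  assumes "bounded_clinear A"
  shows bounded_clinear_adj: "bounded_clinear (adj A)"
    and cinner_adj_right: "cinner x (adj A y) = cinner (A x) y"
    and cinner_adj_left: "cinner (adj A y) x = cinner y (A x)"
proof -
  obtain B where B: "bounded_clinear B" "\<And>x y. cinner (A x) y = cinner x (B y)"
    using adj_exists[OF assms] by blast
  have *: "adj A = B" using B by (rule adj_unique)
  show "bounded_clinear (adj A)" "cinner x (adj A y) = cinner (A x) y" using B * by simp_all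
  then show "cinner (adj A y) x = cinner y (A x)" by (metis cinner_commute)
qed

lemma adj_id: "adj id = id"
  by (rule adj_unique) (auto simp: bounded_clinear_id)

lemma adj_compose:
  assumes "bounded_clinear A" "bounded_clinear B"
  shows "adj (A \<circ> B) = adj B \<circ> adj A"
  by (rule adj_unique)
    (auto simp: assms bounded_clinear_compose bounded_clinear_adj cinner_adj_right)

lemma adj_self_compose_positive:
  assumes "bounded_clinear A"
  shows "positive_op (adj A \<circ> A)"
  unfolding positive_op_def
  by (auto simp: assms bounded_clinear_compose bounded_clinear_adj cinner_adj_left cinner_self)

section \<open>Square roots of positive operators\<close>

lemma positive_op_imp_bounded_clinear: "positive_op A \<Longrightarrow> bounded_clinear A"
  by (simp add: positive_op_def)

lemma positive_op_inner_nonneg: "positive_op A \<Longrightarrow> 0 \<le> inner (A x) x"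
  by (simp add: positive_op_def inner_eq_Re_cinner complex_nonneg_Reals_iff)

text \<open>Polarization: the quadratic form is real at \<open>x + y\<close> and at
  \<open>x + \<i> *\<^sub>C y\<close>, which yields the imaginary and the real part of Hermitian
  symmetry.\<close>

lemma positive_op_selfadjoint:
  assumes A: "positive_op A"
  shows "cinner (A x) y = cinner x (A y)"
proof -
  have bA: "bounded_clinear A" and real: "Im (cinner (A z) z) = 0" for z
    using A by (simp_all add: positive_op_def complex_nonneg_Reals_iff)
  have Im0: "Im (cinner (A x) y + cinner (A y) x) = 0" for x y
    using real[of "x + y"] real[of x] real[of y]
    by (simp add: bounded_clinear_add[OF bA] cinner_add_left cinner_add_right)
  have "cinner (A x) y = cnj (cinner (A y) x)"
    using Im0[of x y] Im0[of x "\<i> *\<^sub>C y"]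
    by (simp add: complex_eq_iff bounded_clinear_scaleC[OF bA] cinner_scaleC_left cinner_scaleC_right)
  then show ?thesis by (metis cinner_commute)
qed

text \<open>Positivity of \<open>A\<close> at \<open>x - A x\<close> gives
  \<open>inner (A x) (A x) \<le> inner (A x) x\<close>; expanding the square of
  \<open>x - A x\<close> then shows that it does not exceed that of \<open>x\<close>.\<close>

lemma positive_op_contraction:
  assumes A: "positive_op A" and le: "\<And>x. norm (A x) \<le> norm x"
  shows "norm (x - A x) \<le> norm x"
proof -
  have bA: "bounded_clinear A" using A by (rule positive_op_imp_bounded_clinear)
  have sa: "inner (A x) y = inner x (A y)" for x y
    by (simp add: inner_eq_Re_cinner positive_op_selfadjoint[OF A])
  have "0 \<le> inner (A (x - A x)) (x - A x)" by (rule positive_op_inner_nonneg[OF A])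
  also have "\<dots> = inner (A x) x - 2 * inner (A x) (A x) + inner (A (A x)) (A x)"
    by (simp add: bounded_clinear_diff[OF bA] inner_diff_left inner_diff_right sa inner_commute)
  also have "inner (A (A x)) (A x) \<le> inner (A x) (A x)"
    using order_trans[OF norm_cauchy_schwarz mult_right_mono[OF le norm_ge_zero]]
    by (metis power2_eq_square power2_norm_eq_inner)
  finally have "inner (A x) (A x) \<le> inner (A x) x" by simp
  then have "inner (A x) (A x) \<le> 2 * inner (A x) x"
    using inner_ge_zero[of "A x"] by linarith
  then have "inner (x - A x) (x - A x) \<le> inner x x"
    by (simp add: inner_diff_left inner_diff_right inner_commute)
  then show ?thesis by (simp add: norm_le)
qed

text \<open>The coefficients of the power series of \<open>sqrt (1 - t)\<close>.\<close>

definition sqrt_coeff :: "nat \<Rightarrow> real" where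
  "sqrt_coeff k = (- 1) ^ k * ((1 / 2) gchoose k)"

lemma gbinomial_Suc_step: "(a gchoose Suc k) = (a - of_nat k) / of_nat (Suc k) * (a gchoose k)"
  for a :: real
  using gbinomial_mult_1[of a k] by (simp add: field_simps)

lemma sqrt_coeff_0: "sqrt_coeff 0 = 1"
  by (simp add: sqrt_coeff_def)

lemma sqrt_coeff_Suc: "sqrt_coeff (Suc k) = (real k - 1 / 2) / real (Suc k) * sqrt_coeff k"
  unfolding sqrt_coeff_def gbinomial_Suc_step by (simp add: field_simps)

lemma sqrt_coeff_nonpos: "k > 0 \<Longrightarrow> sqrt_coeff k \<le> 0"
proof (induction k)
  case (Suc k)
  show ?case
  proof (cases "k = 0")
    case True then show ?thesis by (simp add: sqrt_coeff_Suc sqrt_coeff_0)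
  next
    case False
    then have "sqrt_coeff k \<le> 0" "(real k - 1 / 2) / real (Suc k) \<ge> 0" using Suc.IH by auto
    then show ?thesis unfolding sqrt_coeff_Suc by (rule mult_nonneg_nonpos[rotated])
  qed
qed simp

text \<open>Partial sums are the coefficients of sqrt (1 - t) / (1 - t), that is, of (1 - t) to the
  power -1/2, and those are nonnegative.\<close>

lemma sum_sqrt_coeff_nonneg: "0 \<le> (\<Sum>k\<le>n. sqrt_coeff k)"
proof -
  have "(- 1) ^ m * ((- 1 / 2) gchoose m) \<ge> (0::real)" for m
  proof (induction m)
    case (Suc m)
    have "(- 1) ^ Suc m * ((- 1 / 2) gchoose Suc m)
        = (real m + 1 / 2) / real (Suc m) * ((- 1) ^ m * ((- 1 / 2) gchoose m) :: real)"
      unfolding gbinomial_Suc_step by (simp add: field_simps)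
    with Suc show ?case by simp
  qed simp
  moreover have "(\<Sum>k\<le>n. sqrt_coeff k) = (- 1) ^ n * ((- 1 / 2) gchoose n)"
    using gbinomial_sum_lower_neg[of "1/2 :: real" n] by (simp add: sqrt_coeff_def mult.commute)
  ultimately show ?thesis by simp
qed

text \<open>Only the coefficient at \<open>0\<close>, which is 1, is positive; hence the absolute
  values add up to 2 minus the nonnegative partial sum.\<close>

lemma sum_abs_sqrt_coeff_le: "(\<Sum>k<n. \<bar>sqrt_coeff k\<bar>) \<le> 2"
proof -
  have *: "(\<Sum>k\<le>n. \<bar>sqrt_coeff k\<bar>) = 2 - (\<Sum>k\<le>n. sqrt_coeff k)" for n
    by (induction n) (auto simp: sqrt_coeff_0 sqrt_coeff_nonpos)
  show ?thesis
    using *[of n] sum_sqrt_coeff_nonneg[of n] sum_mono2[of "{..n}" "{..<n}" "\<lambda>k. \<bar>sqrt_coeff k\<bar>"]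
    by force
qed

lemma abs_sqrt_coeff_summable_on: "(\<lambda>k. \<bar>sqrt_coeff k\<bar>) summable_on UNIV"
proof -
  have "summable (\<lambda>k. \<bar>sqrt_coeff k\<bar>)"
    by (rule summableI_nonneg_bounded[where x = 2]) (auto simp: sum_abs_sqrt_coeff_le)
  then show ?thesis by (subst summable_on_UNIV_nonneg_real_iff) auto
qed

lemma sqrt_coeff_summable_on: "sqrt_coeff summable_on UNIV"
  using abs_summable_summable[of sqrt_coeff] abs_sqrt_coeff_summable_on by simp

lemma infsum_sqrt_coeff_nonneg: "0 \<le> infsum sqrt_coeff UNIV"
proof -
  have "sqrt_coeff sums infsum sqrt_coeff UNIV"
    by (intro has_sum_imp_sums has_sum_infsum sqrt_coeff_summable_on)
  then have "(\<lambda>n. \<Sum>k\<le>n. sqrt_coeff k) \<longlonglongrightarrow> infsum sqrt_coeff UNIV"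
    by (simp add: sums_def_le)
  then show ?thesis
    by (rule LIMSEQ_le_const) (auto simp: sum_sqrt_coeff_nonneg)
qed

text \<open>The series squares to 1 - t: Vandermonde's identity turns the convolution into the
  binomial coefficients of 1/2 + 1/2.\<close>

lemma sqrt_coeff_convolution:
  "(\<Sum>j\<le>n. sqrt_coeff j * sqrt_coeff (n - j)) = (if n = 0 then 1 else if n = 1 then - 1 else 0)"
proof -
  have "(\<Sum>j\<le>n. sqrt_coeff j * sqrt_coeff (n - j))
      = (\<Sum>j=0..n. (- 1) ^ n * (((1 / 2) gchoose j) * ((1 / 2) gchoose (n - j))))"
    by (rule sum.cong) (auto simp: sqrt_coeff_def simp flip: power_add)
  also have "\<dots> = (- 1) ^ n * (1 gchoose n)"
    using gbinomial_Vandermonde[of "1/2 :: real" "1/2" n] by (simp flip: sum_distrib_left)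
  also have "(1 gchoose n) = (of_nat (1 choose n) :: real)"
    using binomial_gbinomial[of 1 n, where ?'a = real] by simp
  finally show ?thesis by (cases n) (auto simp: binomial_eq_0)
qed

text \<open>The square root of \<open>I - B\<close> by its binomial series. Absolute summability of
  the coefficients makes it converge for every contraction, including those of norm 1.\<close>

definition contraction_sqrt :: "('a::chilbert_space \<Rightarrow> 'a) \<Rightarrow> 'a \<Rightarrow> 'a" where
  "contraction_sqrt B x = (\<Sum>\<^sub>\<infinity>k. sqrt_coeff k *\<^sub>R (B ^^ k) x)"

context
  fixes B :: "'a::chilbert_space \<Rightarrow> 'a"
  assumes B: "bounded_clinear B" and B_le: "\<And>x. norm (B x) \<le> norm x"
begin

lemma norm_funpow_contraction: "norm ((B ^^ k) x) \<le> norm x"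
  by (induction k) (auto intro: order_trans[OF B_le])

lemma bounded_clinear_funpow: "bounded_clinear (B ^^ k)"
proof (induction k)
  case 0
  show ?case using bounded_clinear_id by (simp add: id_def)
next
  case (Suc k)
  show ?case using bounded_clinear_compose[OF B Suc] by (simp add: o_def)
qed

lemma contraction_sqrt_abs_summable: "(\<lambda>k. sqrt_coeff k *\<^sub>R (B ^^ k) x) abs_summable_on UNIV"
proof (rule summable_on_comparison_test)
  show "(\<lambda>k. \<bar>sqrt_coeff k\<bar> * norm x) summable_on UNIV"
    by (intro summable_on_cmult_left abs_sqrt_coeff_summable_on)
qed (auto intro: mult_left_mono norm_funpow_contraction)

lemma contraction_sqrt_has_sum: "((\<lambda>k. sqrt_coeff k *\<^sub>R (B ^^ k) x) has_sum contraction_sqrt B x) UNIV"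
  unfolding contraction_sqrt_def
  by (rule has_sum_infsum[OF abs_summable_summable[OF contraction_sqrt_abs_summable]])

text \<open>\<open>C\<close> passes through the series term by term. This later makes the positive
  square root commute with everything that commutes with the operator, as its uniqueness
  requires.\<close>

lemma contraction_sqrt_commute:
  assumes C: "bounded_linear C" and BC: "\<And>x. C (B x) = B (C x)"
  shows "C (contraction_sqrt B x) = contraction_sqrt B (C x)"
proof -
  have "C ((B ^^ k) x) = (B ^^ k) (C x)" for k
    by (induction k) (auto simp: BC)
  moreover have "((\<lambda>k. C (sqrt_coeff k *\<^sub>R (B ^^ k) x)) has_sum C (contraction_sqrt B x)) UNIV"
    by (rule has_sum_bounded_linear[OF C contraction_sqrt_has_sum])
  ultimately have "((\<lambda>k. sqrt_coeff k *\<^sub>R (B ^^ k) (C x)) has_sum C (contraction_sqrt B x)) UNIV"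
    by (simp add: linear_scale[OF bounded_linear.linear[OF C]])
  then show ?thesis by (rule has_sum_unique[OF _ contraction_sqrt_has_sum])
qed

lemma bounded_clinear_contraction_sqrt: "bounded_clinear (contraction_sqrt B)"
proof (rule bounded_clinear_intro)
  show "contraction_sqrt B (x + y) = contraction_sqrt B x + contraction_sqrt B y" for x y
    using has_sum_add[OF contraction_sqrt_has_sum[of x] contraction_sqrt_has_sum[of y]]
    unfolding contraction_sqrt_def[of B "x + y"]
    by (intro infsumI) (simp add: bounded_clinear_add[OF bounded_clinear_funpow] scaleR_add_right)
  \<comment> \<open>Multiplication by \<open>c\<close> is itself an operator that commutes with
    \<open>B\<close>.\<close>
  show "contraction_sqrt B (c *\<^sub>C x) = c *\<^sub>C contraction_sqrt B x" for c x
    by (rule contraction_sqrt_commute[symmetric])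
      (simp_all add: bounded_clinear_scaleC[OF B] bounded_linear_scaleC)
  show "norm (contraction_sqrt B x) \<le> norm x * infsum (\<lambda>k. \<bar>sqrt_coeff k\<bar>) UNIV" for x
  proof -
    have "norm (contraction_sqrt B x) \<le> infsum (\<lambda>k. norm (sqrt_coeff k *\<^sub>R (B ^^ k) x)) UNIV"
      unfolding contraction_sqrt_def by (rule norm_infsum_bound[OF contraction_sqrt_abs_summable])
    also have "\<dots> \<le> infsum (\<lambda>k. \<bar>sqrt_coeff k\<bar> * norm x) UNIV"
      by (intro infsum_mono contraction_sqrt_abs_summable summable_on_cmult_left
          abs_sqrt_coeff_summable_on) (auto intro: mult_left_mono norm_funpow_contraction)
    finally show ?thesis by (simp add: infsum_cmult_left') (simp add: mult.commute)
  qed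
qed

text \<open>The double series over \<open>(j, k)\<close> is absolutely summable. Summed by rows it
  is the left-hand side; summed along \<open>j + k = n\<close> it has the coefficients of 1 -
  t.\<close>

lemma contraction_sqrt_square: "contraction_sqrt B (contraction_sqrt B x) = x - B x"
proof -
  let ?d = sqrt_coeff and ?S = "contraction_sqrt B"
  let ?f = "\<lambda>(j, k). (?d j * ?d k) *\<^sub>R (B ^^ (j + k)) x"
  have row: "((\<lambda>k. ?f (j, k)) has_sum ?d j *\<^sub>R (B ^^ j) (?S x)) UNIV" for j
    using has_sum_bounded_linear[OF bounded_linear_compose[OF bounded_linear_scaleR_right[of "?d j"]
          bounded_clinear_imp_bounded_linear[OF bounded_clinear_funpow[of j]]] contraction_sqrt_has_sum[of x]]
    by (simp add: bounded_clinear_scaleR[OF bounded_clinear_funpow] funpow_add)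
  have "?f summable_on UNIV \<times> UNIV"
  proof (rule abs_summable_summable, rule summable_on_comparison_test)
    show "(\<lambda>(j, k). \<bar>?d j\<bar> * (\<bar>?d k\<bar> * norm x)) summable_on UNIV \<times> UNIV"
    proof (rule summable_on_SigmaI)
      show "((\<lambda>k. case (j, k) of (j, k) \<Rightarrow> \<bar>?d j\<bar> * (\<bar>?d k\<bar> * norm x)) has_sum
          \<bar>?d j\<bar> * infsum (\<lambda>k. \<bar>?d k\<bar> * norm x) UNIV) UNIV" for j
        by (auto intro!: has_sum_cmult_right has_sum_infsum summable_on_cmult_left abs_sqrt_coeff_summable_on)
    qed (auto intro: summable_on_cmult_left abs_sqrt_coeff_summable_on)
  qed (auto simp: abs_mult mult.assoc intro!: mult_left_mono norm_funpow_contraction)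
  then obtain s where s: "(?f has_sum s) (UNIV \<times> UNIV)" by (auto simp: summable_on_def)
  have "((\<lambda>j. ?d j *\<^sub>R (B ^^ j) (?S x)) has_sum s) UNIV"
    by (rule has_sum_SigmaD[OF s row])
  then have 1: "?S (?S x) = s" by (rule has_sum_unique[OF contraction_sqrt_has_sum])
  let ?g = "\<lambda>n::nat. if n = 0 then x else if n = 1 then - B x else 0"
  \<comment> \<open>Pairs \<open>(j, k)\<close> are renamed to \<open>(n, j)\<close> with
    \<open>n = j + k\<close>, which groups the terms by the power of \<open>B\<close>.\<close>
  have "((\<lambda>(n, j). (?d j * ?d (n - j)) *\<^sub>R (B ^^ n) x) has_sum s) (SIGMA n:UNIV. {..n})"
    by (rule iffD1[OF has_sum_reindex_bij_witness[where i = "\<lambda>(n, j). (j, n - j)"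
          and j = "\<lambda>(j, k). (j + k, j)"] s]) auto
  then have "((\<lambda>n. \<Sum>j\<le>n. (?d j * ?d (n - j)) *\<^sub>R (B ^^ n) x) has_sum s) UNIV"
    by (rule has_sum_SigmaD) (auto intro: has_sum_finite)
  also have "(\<lambda>n. \<Sum>j\<le>n. (?d j * ?d (n - j)) *\<^sub>R (B ^^ n) x) = ?g"
    by (auto simp: sqrt_coeff_convolution simp flip: scaleR_left.sum)
  finally have "(?g has_sum s) UNIV" .
  moreover have "(?g has_sum (\<Sum>n\<in>{0, 1}. ?g n)) UNIV"
    by (rule has_sum_cong_neutral[THEN iffD1, OF _ _ _ has_sum_finite[of "{0, 1}"]]) auto
  ultimately have "s = (\<Sum>n\<in>{0, 1}. ?g n)" by (rule has_sum_unique)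
  with 1 show ?thesis by simp
qed

text \<open>For \<open>k > 0\<close> the coefficient is nonpositive and the form of
  \<open>B ^^ k\<close> at \<open>x\<close> is at most the squared norm, so the form of the series
  is at least the sum of all coefficients times the squared norm.\<close>

lemma positive_contraction_sqrt:
  assumes sa: "\<And>x y. cinner (B x) y = cinner x (B y)"
  shows "positive_op (contraction_sqrt B)"
  unfolding positive_op_def
proof (intro conjI allI bounded_clinear_contraction_sqrt)
  fix x
  have sak: "cinner ((B ^^ k) x) y = cinner x ((B ^^ k) y)" for k x y
    by (induction k arbitrary: x y) (auto simp: sa funpow_swap1)
  have hs: "((\<lambda>k. of_real (sqrt_coeff k) * cinner ((B ^^ k) x) x) has_sum cinner (contraction_sqrt B x) x) UNIV"
    using has_sum_bounded_linear[OF bounded_linear_cinner_left[of x] contraction_sqrt_has_sum[of x]]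
    by (simp add: cinner_scaleR_left)
  have im: "Im (cinner ((B ^^ k) x) x) = 0" for k
    using arg_cong[OF cinner_commute[of "(B ^^ k) x" x], of Im] by (simp add: sak)
  have re: "sqrt_coeff k * Re (cinner ((B ^^ k) x) x) \<ge> sqrt_coeff k * (norm x)\<^sup>2" for k
  proof (cases "k = 0")
    case True
    then show ?thesis by (simp add: cinner_self)
  next
    case False
    have "Re (cinner ((B ^^ k) x) x) \<le> norm ((B ^^ k) x) * norm x"
      using complex_Re_le_cmod norm_cinner_le order_trans by blast
    also have "\<dots> \<le> norm x * norm x" by (intro mult_right_mono norm_funpow_contraction) auto
    finally show ?thesis
      using False by (intro mult_left_mono_neg sqrt_coeff_nonpos) (auto simp: power2_eq_square)
  qed
  have "infsum sqrt_coeff UNIV * (norm x)\<^sup>2 \<le> Re (cinner (contraction_sqrt B x) x)"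
    by (rule has_sum_mono[OF has_sum_cmult_left[OF has_sum_infsum[OF sqrt_coeff_summable_on]]
          has_sum_Re[OF hs]]) (use re in simp)
  then have "0 \<le> Re (cinner (contraction_sqrt B x) x)"
    using infsum_sqrt_coeff_nonneg by (meson order_trans mult_nonneg_nonneg zero_le_power2)
  moreover have "Im (cinner (contraction_sqrt B x) x) = 0"
    using has_sum_Im[OF hs] by (simp add: im has_sum_unique has_sum_0)
  ultimately show "cinner (contraction_sqrt B x) x \<in> \<real>\<^sub>\<ge>\<^sub>0"
    by (simp add: complex_nonneg_Reals_iff)
qed

end

section \<open>Existence and uniqueness of positive square roots\<close>

lemma positive_op_scaleR:
  assumes "positive_op A" "0 \<le> r"
  shows "positive_op (\<lambda>x. r *\<^sub>R A x)"
  using assms unfolding positive_op_def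
  by (auto simp: bounded_clinear_scaleR_op cinner_scaleR_left complex_nonneg_Reals_iff)

text \<open>Dividing by a bound \<open>K\<close> makes \<open>A\<close> a positive contraction, so
  \<open>B = I - A / K\<close> is a contraction and \<open>sqrt K\<close> times the root of
  \<open>I - B\<close> works. The commutation clause is kept for uniqueness.\<close>

lemma positive_sqrt_exists:
  assumes A: "positive_op A"
  obtains R where "positive_op R" "R \<circ> R = A"
    "\<And>C. bounded_clinear C \<Longrightarrow> (\<And>x. C (A x) = A (C x)) \<Longrightarrow> (\<And>x. C (R x) = R (C x))"
proof -
  have bA: "bounded_clinear A" using A by (rule positive_op_imp_bounded_clinear)
  obtain K where K: "\<And>x. norm (A x) \<le> norm x * K" "K > 0"
    using bounded_linear.pos_bounded[of A] bA by (auto simp: bounded_clinear_def)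
  define A' where "A' = (\<lambda>x. (1 / K) *\<^sub>R A x)"
  define B where "B = (\<lambda>x. x - A' x)"
  have A': "positive_op A'"
    unfolding A'_def using A K by (intro positive_op_scaleR) auto
  have bB: "bounded_clinear B"
    unfolding B_def using bounded_clinear_diff_op[OF bounded_clinear_id positive_op_imp_bounded_clinear[OF A']]
    by simp
  have B_le: "norm (B x) \<le> norm x" for x
    unfolding B_def by (rule positive_op_contraction[OF A']) (use K in \<open>simp add: A'_def field_simps\<close>)
  have sa: "cinner (B x) y = cinner x (B y)" for x y
    by (simp add: B_def cinner_diff_left cinner_diff_right positive_op_selfadjoint[OF A'])
  define S where "S = contraction_sqrt B"
  have pS: "positive_op S" unfolding S_def by (rule positive_contraction_sqrt[OF bB B_le sa])
  note bS = positive_op_imp_bounded_clinear[OF pS]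
  have SS: "S (S x) = A' x" for x
    unfolding S_def contraction_sqrt_square[OF bB B_le] by (simp add: B_def)
  define R where "R = (\<lambda>x. sqrt K *\<^sub>R S x)"
  show ?thesis
  proof (rule that[of R])
    show "positive_op R" unfolding R_def using pS K by (intro positive_op_scaleR) auto
    show "R \<circ> R = A"
      using K by (auto simp: R_def bounded_clinear_scaleR[OF bS] SS A'_def)
    fix C x assume C: "bounded_clinear C" "\<And>x. C (A x) = A (C x)"
    have "C (B x) = B (C x)" for x
      by (simp add: B_def A'_def bounded_clinear_diff[OF C(1)] bounded_clinear_scaleR[OF C(1)] C(2))
    then show "C (R x) = R (C x)"
      unfolding R_def S_def bounded_clinear_scaleR[OF C(1)]
      by (subst contraction_sqrt_commute[OF bB B_le]) (auto simp: C bounded_clinear_imp_bounded_linear)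
  qed
qed

text \<open>With a positive root \<open>R\<close>, the form of \<open>A\<close> at \<open>x\<close>
  is the squared norm of \<open>R x\<close>, and \<open>A x = R (R x)\<close>.\<close>

lemma positive_op_eq_0:
  assumes A: "positive_op A" and 0: "inner (A x) x = 0"
  shows "A x = 0"
proof -
  obtain R where R: "positive_op R" "R \<circ> R = A" using positive_sqrt_exists[OF A] by metis
  have "inner (A x) x = inner (R x) (R x)"
    using R by (auto simp: inner_eq_Re_cinner positive_op_selfadjoint)
  with 0 have "R x = 0" by simp
  then show ?thesis
    using R bounded_clinear_zero[OF positive_op_imp_bounded_clinear] by (metis comp_apply)
qed

text \<open>For \<open>y = R x - R' x\<close>, commutation gives \<open>R y + R' y = 0\<close>; both
  forms are nonnegative, so \<open>R y\<close> and \<open>R' y\<close> vanish, and then so does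
  \<open>y\<close>.\<close>

lemma positive_sqrt_unique:
  assumes R: "positive_op R" and R': "positive_op R'" and eq: "R \<circ> R = R' \<circ> R'"
    and comm: "\<And>x. R' (R x) = R (R' x)"
  shows "R = R'"
proof
  fix x
  note lin = bounded_clinear_diff[OF positive_op_imp_bounded_clinear]
  define y where "y = R x - R' x"
  have "R y + R' y = 0"
    using fun_cong[OF eq, of x] by (simp add: y_def lin[OF R] lin[OF R'] comm)
  then have "inner (R y) y + inner (R' y) y = 0" by (simp flip: inner_add_left)
  then have "inner (R y) y = 0" "inner (R' y) y = 0"
    using positive_op_inner_nonneg[OF R, of y] positive_op_inner_nonneg[OF R', of y] by linarith+
  then have *: "R y = 0" "R' y = 0" by (auto intro: positive_op_eq_0 R R')
  have "cinner y y = cinner x (R y - R' y)"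
    by (subst (1) y_def)
      (simp add: cinner_diff_left cinner_diff_right positive_op_selfadjoint[OF R] positive_op_selfadjoint[OF R'])
  then have "y = 0" using * by simp
  then show "R x = R' x" by (simp add: y_def)
qed

text \<open>Any competing root commutes with its own square \<open>A\<close>, hence with the root
  constructed above, so uniqueness among commuting roots suffices.\<close>

lemma sqrt_op:
  assumes A: "positive_op A"
  shows positive_sqrt_op: "positive_op (sqrt_op A)" and sqrt_op_square: "sqrt_op A (sqrt_op A x) = A x"
proof -
  obtain R where R: "positive_op R" "R \<circ> R = A"
    and comm: "\<And>C x. bounded_clinear C \<Longrightarrow> (\<And>x. C (A x) = A (C x)) \<Longrightarrow> C (R x) = R (C x)"
    using positive_sqrt_exists[OF A] by metis
  have "sqrt_op A = R"
    unfolding sqrt_op_def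
  proof (rule the_equality)
    fix R' assume R': "positive_op R' \<and> R' \<circ> R' = A"
    have "R' (A x) = A (R' x)" for x using R' by (metis comp_apply)
    then have "R' (R x) = R (R' x)" for x
      using R' by (intro comm positive_op_imp_bounded_clinear) auto
    with R R' show "R' = R"
      using positive_sqrt_unique[of R R'] by simp
  qed (use R in auto)
  with R show "positive_op (sqrt_op A)" "sqrt_op A (sqrt_op A x) = A x" by auto
qed

lemma closed_csubspace_closure_range:
  assumes A: "bounded_clinear A"
  shows "closed_csubspace (closure (range A))"
  unfolding closed_csubspace_def
proof (intro conjI ballI allI)
  show "0 \<in> closure (range A)"
    using closure_subset[of "range A"] bounded_clinear_zero[OF A] by (metis rangeI subsetD)
  fix x assume "x \<in> closure (range A)"
  then obtain u where u: "\<And>n. u n \<in> range A" "u \<longlonglongrightarrow> x"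
    unfolding closure_sequential by metis
  show "x + y \<in> closure (range A)" if y: "y \<in> closure (range A)" for y
  proof -
    obtain v where v: "\<And>n. v n \<in> range A" "v \<longlonglongrightarrow> y"
      using y unfolding closure_sequential by metis
    have "u n + v n \<in> range A" for n
      using u(1)[of n] v(1)[of n] by (auto simp flip: bounded_clinear_add[OF A])
    then show ?thesis
      unfolding closure_sequential
      by (intro exI[of _ "\<lambda>n. u n + v n"] conjI allI tendsto_add[OF u(2) v(2)])
  qed
  show "c *\<^sub>C x \<in> closure (range A)" for c
  proof -
    have "c *\<^sub>C u n \<in> range A" for n
      using u(1)[of n] by (auto simp flip: bounded_clinear_scaleC[OF A])
    then show ?thesis
      unfolding closure_sequential
      by (intro exI[of _ "\<lambda>n. c *\<^sub>C u n"] conjI allI bounded_linear.tendsto[OF bounded_linear_scaleC u(2)])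
  qed
qed simp

text \<open>The component \<open>n\<close> of \<open>sqrt_op A x\<close> orthogonal to the range of
  \<open>A\<close> is killed by the root, hence orthogonal to \<open>sqrt_op A x\<close> and to
  itself. This places the Berezin kernel over the defect space.\<close>

lemma sqrt_op_range:
  assumes A: "positive_op A"
  shows "sqrt_op A x \<in> closure (range A)"
proof -
  let ?R = "sqrt_op A"
  note R = positive_sqrt_op[OF A] and sa = positive_op_selfadjoint[OF positive_sqrt_op[OF A]]
  obtain m where m: "m \<in> closure (range A)" "\<And>y. y \<in> closure (range A) \<Longrightarrow> cinner (?R x - m) y = 0"
    using closed_csubspace_projection[OF closed_csubspace_closure_range[OF positive_op_imp_bounded_clinear[OF A]]]
    by metis
  define n where "n = ?R x - m"
  have "A n \<in> closure (range A)" using closure_subset[of "range A"] by blast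
  then have "cinner n (A n) = 0" using m(2) by (simp add: n_def)
  then have "cinner (?R n) (?R n) = 0" by (simp only: sa sqrt_op_square[OF A])
  then have "?R n = 0" by simp
  then have "cinner (?R x) n = 0" by (simp add: sa)
  moreover have "cinner m n = 0"
    using m by (subst cinner_commute) (simp add: n_def)
  ultimately have "n = 0" by (metis n_def cinner_diff_left cinner_eq_zero_iff diff_zero)
  then show ?thesis using m(1) by (simp add: n_def)
qed

section \<open>Inverses of power series in noncommuting indeterminates\<close>

lemma nc_mult_eq_sum_take_drop:
  "nc_mult c d \<alpha> = (\<Sum>k\<le>length \<alpha>. c (take k \<alpha>) * d (drop k \<alpha>))"
  unfolding nc_mult_def
  by (rule sum.reindex_bij_witness[where i = "\<lambda>k. (take k \<alpha>, drop k \<alpha>)" and j = "\<lambda>(\<beta>, \<gamma>). length \<beta>"]) auto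

text \<open>Both sides sum over two cut points of the word, given either as \<open>j \<le> k\<close>
  or as the first cut \<open>j\<close> and the length \<open>i\<close> of the middle piece.\<close>

lemma nc_mult_assoc: "nc_mult (nc_mult c d) e = nc_mult c (nc_mult d e)"
proof
  fix \<alpha>
  let ?t = "\<lambda>j k. c (take j \<alpha>) * d (drop j (take k \<alpha>)) * e (drop k \<alpha>)"
  have "nc_mult (nc_mult c d) e \<alpha> = (\<Sum>(k, j) \<in> (SIGMA k:{..length \<alpha>}. {..k}). ?t j k)"
    unfolding nc_mult_eq_sum_take_drop
    by (simp add: sum.Sigma[symmetric] sum_distrib_right min_absorb2 min_absorb1)
  also have "\<dots> = (\<Sum>(j, i) \<in> (SIGMA j:{..length \<alpha>}. {..length \<alpha> - j}). ?t j (j + i))"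
    by (rule sum.reindex_bij_witness[where i = "\<lambda>(j, i). (j + i, j)" and j = "\<lambda>(k, j). (j, k - j)"]) auto
  also have "\<dots> = nc_mult c (nc_mult d e) \<alpha>"
    unfolding nc_mult_eq_sum_take_drop
    by (simp add: sum.Sigma[symmetric] sum_distrib_left mult.assoc drop_take add.commute)
  finally show "nc_mult (nc_mult c d) e \<alpha> = nc_mult c (nc_mult d e) \<alpha>" .
qed

lemma nc_mult_one_left: "nc_mult nc_one c = c"
proof
  fix \<alpha>
  have "nc_mult nc_one c \<alpha> = (\<Sum>k\<in>{0}. c (drop k \<alpha>))"
    unfolding nc_mult_eq_sum_take_drop nc_one_def by (rule sum.mono_neutral_cong_right) auto
  then show "nc_mult nc_one c \<alpha> = c \<alpha>" by simp
qed

lemma nc_mult_one_right: "nc_mult c nc_one = c"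
proof
  fix \<alpha>
  have "nc_mult c nc_one \<alpha> = (\<Sum>k\<in>{length \<alpha>}. c (take k \<alpha>))"
    unfolding nc_mult_eq_sum_take_drop nc_one_def by (rule sum.mono_neutral_cong_right) auto
  then show "nc_mult c nc_one \<alpha> = c \<alpha>" by simp
qed

text \<open>The recursion solves \<open>nc_mult d c = nc_one\<close> for the coefficient of
  \<open>d\<close> at the whole word, which stands alone when \<open>c [] = 1\<close>.\<close>

function nc_left_inverse :: "('n list \<Rightarrow> 'c::comm_ring_1) \<Rightarrow> 'n list \<Rightarrow> 'c" where
  "nc_left_inverse c \<alpha> =
    (if \<alpha> = [] then 1 else - (\<Sum>k<length \<alpha>. nc_left_inverse c (take k \<alpha>) * c (drop k \<alpha>)))"
  by auto
termination by (relation "Wellfounded.measure (length \<circ> snd)") auto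

declare nc_left_inverse.simps [simp del]

lemma nc_left_inverse:
  assumes "c [] = 1"
  shows "nc_mult (nc_left_inverse c) c = nc_one"
proof
  fix \<alpha>
  have "nc_mult (nc_left_inverse c) c \<alpha> =
      (\<Sum>k<length \<alpha>. nc_left_inverse c (take k \<alpha>) * c (drop k \<alpha>)) + nc_left_inverse c \<alpha>"
    using assms unfolding nc_mult_eq_sum_take_drop by (simp add: lessThan_Suc_atMost[symmetric])
  then show "nc_mult (nc_left_inverse c) c \<alpha> = nc_one \<alpha>"
    using nc_left_inverse.simps[of c \<alpha>] by (cases "\<alpha> = []") (simp_all add: nc_one_def)
qed

text \<open>The left inverse of the left inverse is \<open>c\<close> by associativity, so the
  recursive inverse is two-sided and satisfies the definite description.\<close>

lemma nc_mult_inverse_left: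
  assumes c: "c [] = 1"
  shows "nc_mult (nc_inverse c) c = nc_one"
proof -
  let ?a = "nc_left_inverse c"
  let ?a' = "nc_left_inverse ?a"
  have "?a [] = 1" by (simp add: nc_left_inverse.simps)
  then have a': "nc_mult ?a' ?a = nc_one" by (rule nc_left_inverse)
  have a: "nc_mult ?a c = nc_one" using c by (rule nc_left_inverse)
  have "?a' = c"
    by (metis a a' nc_mult_assoc nc_mult_one_left nc_mult_one_right)
  with a' have "nc_mult c ?a = nc_one" by simp
  with a have "nc_inverse c = ?a"
    unfolding nc_inverse_def
    by (intro the_equality) (auto, metis nc_mult_assoc nc_mult_one_left nc_mult_one_right)
  with a show ?thesis by simp
qed

section \<open>The standard basis of the Fock space\<close>

lemma ell2_eqI: "(\<And>i. ell2_coord x i = ell2_coord y i) \<Longrightarrow> x = y"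
  by (metis ell2_coord_inject ext)

lemma ell2_coord_sum: "ell2_coord (\<Sum>i\<in>I. f i) j = (\<Sum>i\<in>I. ell2_coord (f i) j)"
  by (induction I rule: infinite_finite_induct) (auto simp: zero_ell2.rep_eq plus_ell2.rep_eq)

lemma square_summable_ell2_coord: "square_summable (ell2_coord x)"
  using ell2_coord by blast

lemma bounded_clinear_ell2_coord: "bounded_clinear (\<lambda>x. ell2_coord x i)"
  by (rule bounded_clinear_intro[where K = 1])
    (auto simp: plus_ell2.rep_eq scaleC_ell2.rep_eq norm_ell2_coord_le)

text \<open>Pairing with elementary tensors reads off coordinates; adjoints are computed this
  way.\<close>

lemma cinner_basis_tensor:
  "cinner x (tensor (fock_basis \<alpha>) d) = cinner (ell2_coord x \<alpha>) d"
proof -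
  have "cinner x (tensor (fock_basis \<alpha>) d) = infsum (\<lambda>\<beta>. cinner (ell2_coord x \<beta>) d) {\<alpha>}"
    unfolding cinner_ell2.rep_eq tensor.rep_eq fock_basis.rep_eq
    by (rule infsum_cong_neutral) auto
  then show ?thesis by simp
qed

lemma norm_fock_basis: "norm (fock_basis \<alpha>) = 1"
proof -
  have "complex_of_real ((norm (fock_basis \<alpha>))\<^sup>2) = 1"
    unfolding cinner_self[symmetric] by (simp add: cinner_fock_basis)
  then have "(norm (fock_basis \<alpha>))\<^sup>2 = 1" by (simp only: of_real_eq_1_iff)
  then show ?thesis using norm_ge_zero[of "fock_basis \<alpha>"] by (auto simp: power2_eq_1_iff)
qed

text \<open>By orthogonality the squared error of a finite partial sum is the remainder of the norm
  series.\<close>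

lemma tensor_basis_has_sum:
  fixes x :: "('n list, 'd::chilbert_space) ell2"
  shows "((\<lambda>\<alpha>. tensor (fock_basis \<alpha>) (ell2_coord x \<alpha>)) has_sum x) UNIV"
proof -
  let ?t = "\<lambda>\<alpha>. tensor (fock_basis \<alpha>) (ell2_coord x \<alpha>)"
  have orth: "inner (?t \<alpha>) (?t \<beta>) = (if \<alpha> = \<beta> then (norm (ell2_coord x \<alpha>))\<^sup>2 else 0)" for \<alpha> \<beta>
    by (simp add: inner_eq_Re_cinner cinner_tensor cinner_fock_basis cinner_self)
  have dist: "(norm ((\<Sum>\<alpha>\<in>F. ?t \<alpha>) - x))\<^sup>2 = (norm x)\<^sup>2 - (\<Sum>\<alpha>\<in>F. (norm (ell2_coord x \<alpha>))\<^sup>2)"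
    if F: "finite F" for F
  proof -
    have 1: "inner x (\<Sum>\<alpha>\<in>F. ?t \<alpha>) = (\<Sum>\<alpha>\<in>F. (norm (ell2_coord x \<alpha>))\<^sup>2)"
      by (subst inner_sum_right) (simp add: inner_eq_Re_cinner cinner_basis_tensor cinner_self)
    have 2: "inner (\<Sum>\<alpha>\<in>F. ?t \<alpha>) (\<Sum>\<alpha>\<in>F. ?t \<alpha>) = (\<Sum>\<alpha>\<in>F. (norm (ell2_coord x \<alpha>))\<^sup>2)"
      using F by (simp add: inner_sum_left inner_sum_right orth)
    show ?thesis
      unfolding power2_norm_eq_inner inner_diff_left inner_diff_right
      using 1 2 by (simp add: inner_commute power2_norm_eq_inner)
  qed
  have "((\<lambda>\<alpha>. (norm (ell2_coord x \<alpha>))\<^sup>2) has_sum (norm x)\<^sup>2) UNIV"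
    unfolding norm_ell2_power2
    using square_summable_ell2_coord[of x] by (simp add: square_summable_def)
  then have "((\<lambda>F. (norm x)\<^sup>2 - (\<Sum>\<alpha>\<in>F. (norm (ell2_coord x \<alpha>))\<^sup>2)) \<longlongrightarrow> (norm x)\<^sup>2 - (norm x)\<^sup>2)
      (finite_subsets_at_top UNIV)"
    unfolding has_sum_def by (intro tendsto_intros)
  then have "((\<lambda>F. (norm x)\<^sup>2 - (\<Sum>\<alpha>\<in>F. (norm (ell2_coord x \<alpha>))\<^sup>2)) \<longlongrightarrow> 0)
      (finite_subsets_at_top UNIV)" by simp
  moreover have "\<forall>\<^sub>F F in finite_subsets_at_top UNIV.
      (norm x)\<^sup>2 - (\<Sum>\<alpha>\<in>F. (norm (ell2_coord x \<alpha>))\<^sup>2) = (norm ((\<Sum>\<alpha>\<in>F. ?t \<alpha>) - x))\<^sup>2"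
    by (rule eventually_finite_subsets_at_top_weakI) (simp add: dist)
  ultimately have "((\<lambda>F. (norm ((\<Sum>\<alpha>\<in>F. ?t \<alpha>) - x))\<^sup>2) \<longlongrightarrow> 0) (finite_subsets_at_top UNIV)"
    by (rule Lim_transform_eventually)
  then have "((\<lambda>F. sqrt ((norm ((\<Sum>\<alpha>\<in>F. ?t \<alpha>) - x))\<^sup>2)) \<longlongrightarrow> sqrt 0) (finite_subsets_at_top UNIV)"
    by (rule tendsto_real_sqrt)
  then show ?thesis
    unfolding has_sum_def by (subst tendsto_iff) (simp add: tendsto_iff dist_norm)
qed

text \<open>Supplies the uniqueness behind the definite descriptions of \<open>ampliation\<close>
  and \<open>weighted_creation\<close>.\<close>

lemma bounded_clinear_eq_on_tensor:
  assumes A: "bounded_clinear A" and B: "bounded_clinear B"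
    and eq: "\<And>\<alpha> d. A (tensor (fock_basis \<alpha>) d) = B (tensor (fock_basis \<alpha>) d)"
  shows "A = B"
proof
  fix x
  have "((\<lambda>\<alpha>. A (tensor (fock_basis \<alpha>) (ell2_coord x \<alpha>))) has_sum A x) UNIV"
    by (rule has_sum_bounded_linear[OF bounded_clinear_imp_bounded_linear[OF A] tensor_basis_has_sum])
  moreover have "((\<lambda>\<alpha>. B (tensor (fock_basis \<alpha>) (ell2_coord x \<alpha>))) has_sum B x) UNIV"
    by (rule has_sum_bounded_linear[OF bounded_clinear_imp_bounded_linear[OF B] tensor_basis_has_sum])
  ultimately show "A x = B x" unfolding eq by (rule has_sum_unique)
qed

lemma ampliation_eqI:
  assumes "bounded_clinear S" "\<And>f d. S (tensor f d) = tensor (A f) d"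
  shows "ampliation A = S"
  unfolding ampliation_def
  using assms by (intro the_equality) (auto intro!: bounded_clinear_eq_on_tensor)

lemma tensor_basis_complex: "tensor (fock_basis \<alpha>) c = c *\<^sub>C fock_basis \<alpha>"
  by (rule ell2_eqI) (simp add: tensor.rep_eq scaleC_ell2.rep_eq scaleC_complex_def mult.commute)

lemma in_fock_tensorI:
  assumes "\<And>\<alpha>. ell2_coord x \<alpha> \<in> D"
  shows "x \<in> fock_tensor D"
  unfolding fock_tensor_def
proof (rule Lim_in_closed_set[OF closed_closure _ _ tensor_basis_has_sum[unfolded has_sum_def]])
  have "(\<Sum>\<alpha>\<in>F. tensor (fock_basis \<alpha>) (ell2_coord x \<alpha>)) \<in> span {tensor f d |f d. d \<in> D}" for F
    by (intro span_sum span_base) (use assms in blast)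
  then show "\<forall>\<^sub>F F in finite_subsets_at_top UNIV.
      (\<Sum>\<alpha>\<in>F. tensor (fock_basis \<alpha>) (ell2_coord x \<alpha>)) \<in> closure (span {tensor f d |f d. d \<in> D})"
    using closure_subset by (intro always_eventually) blast
qed simp

section \<open>Weighted creation operators with vector coefficients\<close>

text \<open>The operator \<open>W\<^sub>i \<otimes> I\<close>, in coordinates.\<close>

definition creation :: "('n list \<Rightarrow> real) \<Rightarrow> 'n \<Rightarrow> ('n list, 'd::chilbert_space) ell2 \<Rightarrow> ('n list, 'd) ell2"
  where "creation b i f = Abs_ell2 (\<lambda>\<gamma>. if \<gamma> \<noteq> [] \<and> hd \<gamma> = i
    then sqrt (b (tl \<gamma>) / b \<gamma>) *\<^sub>R ell2_coord f (tl \<gamma>) else 0)"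

locale weight_family =
  fixes b :: "'n::finite list \<Rightarrow> real"
  assumes b_Nil: "b [] = 1" and b_pos: "0 < b \<alpha>"
    and b_ratio_bdd: "bdd_above (range (\<lambda>\<alpha>. b \<alpha> / b (i # \<alpha>)))"
begin

text \<open>The family lives on the words starting with \<open>i\<close>; reindexing by
  \<open>Cons i\<close> compares it with \<open>f\<close>, weighted by ratios that \<open>C\<close>
  bounds.\<close>

lemma creation_summable:
  fixes f :: "('n list, 'd::chilbert_space) ell2" and i :: 'n
  defines "g \<equiv> \<lambda>\<gamma>. if \<gamma> \<noteq> [] \<and> hd \<gamma> = i
    then sqrt (b (tl \<gamma>) / b \<gamma>) *\<^sub>R ell2_coord f (tl \<gamma>) else 0"
  assumes C: "\<And>\<alpha>. b \<alpha> / b (i # \<alpha>) \<le> C"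
  shows "square_summable g" and "infsum (\<lambda>\<gamma>. (norm (g \<gamma>))\<^sup>2) UNIV \<le> C * (norm f)\<^sup>2"
proof -
  have sf: "(\<lambda>\<beta>. (norm (ell2_coord f \<beta>))\<^sup>2) summable_on UNIV"
    using square_summable_ell2_coord[of f] by (simp add: square_summable_def)
  have g_Cons: "(norm (g (i # \<beta>)))\<^sup>2 = b \<beta> / b (i # \<beta>) * (norm (ell2_coord f \<beta>))\<^sup>2" for \<beta>
    using b_pos[of \<beta>] b_pos[of "i # \<beta>"] by (simp add: g_def power_mult_distrib)
  have le: "(norm (g (i # \<beta>)))\<^sup>2 \<le> C * (norm (ell2_coord f \<beta>))\<^sup>2" for \<beta>
    unfolding g_Cons by (intro mult_right_mono C) simp
  have sg: "(\<lambda>\<beta>. (norm (g (i # \<beta>)))\<^sup>2) summable_on UNIV"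
    by (rule summable_on_comparison_test[OF summable_on_cmult_right[OF sf] le]) auto
  have hs: "((\<lambda>\<gamma>. (norm (g \<gamma>))\<^sup>2) has_sum infsum (\<lambda>\<beta>. (norm (g (i # \<beta>)))\<^sup>2) UNIV) UNIV"
  proof -
    have "((\<lambda>\<gamma>. (norm (g \<gamma>))\<^sup>2) has_sum infsum (\<lambda>\<beta>. (norm (g (i # \<beta>)))\<^sup>2) UNIV) (range (Cons i))"
      by (subst has_sum_reindex) (use sg in \<open>auto simp: o_def\<close>)
    then show ?thesis
      by (rule has_sum_cong_neutral[THEN iffD1, rotated -1]) (auto simp: g_def neq_Nil_conv)
  qed
  then show "square_summable g" by (auto simp: square_summable_def summable_on_def)
  have "infsum (\<lambda>\<gamma>. (norm (g \<gamma>))\<^sup>2) UNIV = infsum (\<lambda>\<beta>. (norm (g (i # \<beta>)))\<^sup>2) UNIV"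
    using hs by (rule infsumI)
  also have "\<dots> \<le> infsum (\<lambda>\<beta>. C * (norm (ell2_coord f \<beta>))\<^sup>2) UNIV"
    by (rule infsum_mono[OF sg summable_on_cmult_right[OF sf] le])
  finally show "infsum (\<lambda>\<gamma>. (norm (g \<gamma>))\<^sup>2) UNIV \<le> C * (norm f)\<^sup>2"
    by (simp add: infsum_cmult_right' norm_ell2_power2)
qed

lemma b_ratio_bound:
  obtains C where "\<And>\<alpha>. b \<alpha> / b (i # \<alpha>) \<le> C"
  using b_ratio_bdd[of i] unfolding bdd_above_def by auto

lemma ell2_coord_creation:
  "ell2_coord (creation b i f) \<gamma> =
    (if \<gamma> \<noteq> [] \<and> hd \<gamma> = i then sqrt (b (tl \<gamma>) / b \<gamma>) *\<^sub>R ell2_coord f (tl \<gamma>) else 0)"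
proof -
  obtain C where "\<And>\<alpha>. b \<alpha> / b (i # \<alpha>) \<le> C" using b_ratio_bound by blast
  from creation_summable(1)[OF this, of f] show ?thesis
    unfolding creation_def by (subst Abs_ell2_inverse) auto
qed

lemma bounded_clinear_creation: "bounded_clinear (creation b i)"
proof -
  obtain C where C: "\<And>\<alpha>. b \<alpha> / b (i # \<alpha>) \<le> C" using b_ratio_bound by blast
  show ?thesis
  proof (rule bounded_clinear_intro)
    fix x
    have "(norm (creation b i x))\<^sup>2 \<le> C * (norm x)\<^sup>2"
      unfolding norm_ell2_power2[of "creation b i x"] ell2_coord_creation
      by (rule creation_summable(2)[OF C])
    then have "norm (creation b i x) \<le> sqrt (C * (norm x)\<^sup>2)" by (rule real_le_rsqrt)
    then show "norm (creation b i x) \<le> norm x * sqrt C"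
      by (simp add: real_sqrt_mult mult.commute)
  qed (auto intro!: ell2_eqI simp: ell2_coord_creation plus_ell2.rep_eq scaleC_ell2.rep_eq
      scaleR_add_right scaleC_scaleR)
qed

lemma creation_tensor: "creation b i (tensor f d) = tensor (creation b i f) d"
  by (rule ell2_eqI)
    (simp add: ell2_coord_creation tensor.rep_eq scaleC_scaleC scaleR_conv_of_real flip: scaleC_of_real)

lemma creation_tensor_basis:
  "creation b i (tensor (fock_basis \<beta>) d) = sqrt (b \<beta> / b (i # \<beta>)) *\<^sub>R tensor (fock_basis (i # \<beta>)) d"
  by (rule ell2_eqI)
    (auto simp: ell2_coord_creation tensor.rep_eq scaleR_ell2.rep_eq fock_basis.rep_eq neq_Nil_conv)

lemma ell2_coord_adj_creation:
  "ell2_coord (adj (creation b i) f) \<beta> = sqrt (b \<beta> / b (i # \<beta>)) *\<^sub>R ell2_coord f (i # \<beta>)"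
proof (rule cinner_ext)
  fix d
  have "cinner (ell2_coord (adj (creation b i) f) \<beta>) d = cinner f (creation b i (tensor (fock_basis \<beta>) d))"
    unfolding cinner_basis_tensor[symmetric] by (rule cinner_adj_left[OF bounded_clinear_creation])
  also have "\<dots> = cinner (sqrt (b \<beta> / b (i # \<beta>)) *\<^sub>R ell2_coord f (i # \<beta>)) d"
    by (simp add: creation_tensor_basis cinner_scaleR_right cinner_scaleR_left cinner_basis_tensor)
  finally show "cinner (ell2_coord (adj (creation b i) f) \<beta>) d
    = cinner (sqrt (b \<beta> / b (i # \<beta>)) *\<^sub>R ell2_coord f (i # \<beta>)) d" .
qed

lemma adj_creation_tensor: "adj (creation b i) (tensor f d) = tensor (adj (creation b i) f) d"
  by (rule ell2_eqI)
    (simp add: ell2_coord_adj_creation tensor.rep_eq scaleC_scaleC scaleR_conv_of_real flip: scaleC_of_real)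

text \<open>The Fock space is the case of complex coefficients, so the coordinate formula realizes
  the operator described by its values on the basis.\<close>

lemma weighted_creation_eq_creation: "weighted_creation b i = creation b i"
  unfolding weighted_creation_def
proof (rule the_equality)
  have *: "creation b i (fock_basis \<alpha>) = sqrt (b \<alpha> / b (i # \<alpha>)) *\<^sub>R fock_basis (i # \<alpha>)" for \<alpha>
    using creation_tensor_basis[of i \<alpha> "1::complex"] by (simp add: tensor_basis_complex)
  then show "bounded_clinear (creation b i) \<and>
      (\<forall>\<alpha>. creation b i (fock_basis \<alpha>) = sqrt (b \<alpha> / b (i # \<alpha>)) *\<^sub>R fock_basis (i # \<alpha>))"
    using bounded_clinear_creation by blast
  fix W :: "'n fock \<Rightarrow> 'n fock"
  assume W: "bounded_clinear W \<and> (\<forall>\<alpha>. W (fock_basis \<alpha>) = sqrt (b \<alpha> / b (i # \<alpha>)) *\<^sub>R fock_basis (i # \<alpha>))"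
  then show "W = creation b i"
    by (intro bounded_clinear_eq_on_tensor bounded_clinear_creation)
      (auto simp: tensor_basis_complex * bounded_clinear_scaleC bounded_clinear_creation)
qed

lemma ampliation_weighted_creation: "ampliation (weighted_creation b i) = creation b i"
  by (rule ampliation_eqI)
    (simp_all add: bounded_clinear_creation weighted_creation_eq_creation creation_tensor)

lemma ampliation_adj_weighted_creation: "ampliation (adj (weighted_creation b i)) = adj (creation b i)"
  by (rule ampliation_eqI)
    (simp_all add: bounded_clinear_adj bounded_clinear_creation weighted_creation_eq_creation adj_creation_tensor)

end

lemma bounded_clinear_word_op:
  "(\<And>i. bounded_clinear (X i)) \<Longrightarrow> bounded_clinear (word_op X \<alpha>)"
  by (induction \<alpha>) (auto intro: bounded_clinear_id bounded_clinear_compose)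

lemma adj_word_op_Cons:
  "(\<And>i. bounded_clinear (X i)) \<Longrightarrow> adj (word_op X (i # \<alpha>)) x = adj (word_op X \<alpha>) (adj (X i) x)"
  by (simp add: adj_compose bounded_clinear_word_op)

context weight_family
begin

text \<open>The weights telescope along the word, leaving a single quotient of values of
  \<open>b\<close>.\<close>

lemma ell2_coord_word_creation:
  "ell2_coord (word_op (creation b) \<alpha> f) \<gamma> =
    (if take (length \<alpha>) \<gamma> = \<alpha> then sqrt (b (drop (length \<alpha>) \<gamma>) / b \<gamma>) *\<^sub>R ell2_coord f (drop (length \<alpha>) \<gamma>)
     else 0)"
proof (induction \<alpha> arbitrary: \<gamma>)
  case Nil
  show ?case using b_pos[of \<gamma>] by simp
next
  case (Cons i \<alpha>)
  show ?case
  proof (cases \<gamma>)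
    case (Cons j \<delta>)
    show ?thesis
      using Cons.IH[of \<delta>] b_pos[of \<delta>] by (auto simp: Cons ell2_coord_creation simp flip: real_sqrt_mult)
  qed (simp add: ell2_coord_creation)
qed

lemma ell2_coord_adj_word_creation:
  "ell2_coord (adj (word_op (creation b) \<alpha>) f) \<beta> = sqrt (b \<beta> / b (\<alpha> @ \<beta>)) *\<^sub>R ell2_coord f (\<alpha> @ \<beta>)"
proof (induction \<alpha> arbitrary: f)
  case Nil
  show ?case unfolding word_op.simps adj_id using b_pos[of \<beta>] by simp
next
  case (Cons i \<alpha>)
  show ?case
    using b_pos[of "\<alpha> @ \<beta>"]
    by (simp add: adj_word_op_Cons bounded_clinear_creation Cons.IH ell2_coord_adj_creation
        del: word_op.simps flip: real_sqrt_mult)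
qed

end

section \<open>The truncated defect of the weighted creation operators\<close>

lemma finite_words_length_eq: "finite {\<alpha> :: 'n::finite list. length \<alpha> = p}"
  using finite_lists_length_eq[of "UNIV :: 'n set" p] by simp

lemma finite_words_length_le: "finite {\<alpha> :: 'n::finite list. length \<alpha> \<le> p}"
  using finite_lists_length_le[of "UNIV :: 'n set" p] by simp

text \<open>Lets unordered sums over words be computed as limits of truncations by length.\<close>

lemma filterlim_words_length_le:
  "filterlim (\<lambda>n. {\<gamma> :: 'n::finite list. length \<gamma> \<le> n}) (finite_subsets_at_top UNIV) sequentially"
  unfolding filterlim_finite_subsets_at_top
proof (intro allI impI)
  fix X :: "'n list set" assume "finite X \<and> X \<subseteq> UNIV"
  then have "finite (length ` X)" by blast
  then obtain N where "\<forall>l\<in>length ` X. l \<le> N" using finite_nat_set_iff_bounded_le by blast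
  then show "\<forall>\<^sub>F n in sequentially. finite {\<gamma> :: 'n list. length \<gamma> \<le> n} \<and>
      X \<subseteq> {\<gamma>. length \<gamma> \<le> n} \<and> {\<gamma> :: 'n list. length \<gamma> \<le> n} \<subseteq> UNIV"
    unfolding eventually_sequentially by (intro exI[of _ N]) (auto simp: finite_words_length_le)
qed

lemma has_sum_diff:
  fixes f g :: "'i \<Rightarrow> 'a::topological_ab_group_add"
  assumes "(f has_sum a) A" "(g has_sum b) A"
  shows "((\<lambda>i. f i - g i) has_sum (a - b)) A"
  using has_sum_add[OF assms(1) has_sum_uminus[THEN iffD2], of g "- b"] assms(2) by simp

text \<open>The part of the defect of degree \<open>p\<close>, for any tuple, so that layers of
  \<open>T\<close> can be compared with those of \<open>creation b\<close>.\<close>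

definition defect_layer ::
    "('n::finite list \<Rightarrow> real) \<Rightarrow> ('n \<Rightarrow> 'h::chilbert_space \<Rightarrow> 'h) \<Rightarrow> nat \<Rightarrow> 'h \<Rightarrow> 'h" where
  "defect_layer b X p x = (\<Sum>\<alpha> | length \<alpha> = p. nc_inverse b \<alpha> *\<^sub>R word_op X \<alpha> (adj (word_op X \<alpha>) x))"

lemma bounded_clinear_defect_layer:
  assumes "\<And>i. bounded_clinear (X i)"
  shows "bounded_clinear (defect_layer b X p)"
proof -
  have "bounded_clinear (word_op X \<alpha> \<circ> adj (word_op X \<alpha>))" for \<alpha>
    by (rule bounded_clinear_compose[OF _ bounded_clinear_adj]; rule bounded_clinear_word_op[OF assms])
  from bounded_clinear_sum_op[OF bounded_clinear_scaleR_op[OF this]] show ?thesis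
    by (simp add: defect_layer_def[abs_def])
qed

lemma cinner_defect_layer:
  assumes "\<And>i. bounded_clinear (X i)"
  shows "cinner (defect_layer b X p x) y =
    (\<Sum>\<alpha> | length \<alpha> = p. of_real (nc_inverse b \<alpha>) * cinner (adj (word_op X \<alpha>) x) (adj (word_op X \<alpha>) y))"
  unfolding defect_layer_def
  by (simp add: cinner_sum_left cinner_scaleR_left cinner_adj_right bounded_clinear_word_op assms)

text \<open>The diagonal entry at the basis vector of \<gamma> of the defect of the weighted
  creation operators truncated at degree \<open>k\<close>. A layer beyond the length of \<gamma>
  contributes 0, as \<gamma> has no prefix that long.\<close>

definition (in weight_family) defect_multiplier :: "nat \<Rightarrow> 'n list \<Rightarrow> real" where
  "defect_multiplier k \<gamma> =
    (\<Sum>p\<le>k. if p \<le> length \<gamma> then nc_inverse b (take p \<gamma>) * b (drop p \<gamma>) / b \<gamma> else 0)"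

context weight_family
begin

text \<open>Each product of a word operator with its adjoint is diagonal, and among the words of
  length \<open>p\<close> only the prefix of \<gamma> acts on coordinate \<gamma>.\<close>

lemma ell2_coord_defect_layer:
  "ell2_coord (defect_layer b (creation b) p f) \<gamma> =
    (if p \<le> length \<gamma> then nc_inverse b (take p \<gamma>) * b (drop p \<gamma>) / b \<gamma> else 0) *\<^sub>R ell2_coord f \<gamma>"
proof -
  let ?t = "\<lambda>\<alpha>. nc_inverse b \<alpha> *\<^sub>R ell2_coord (word_op (creation b) \<alpha> (adj (word_op (creation b) \<alpha>) f)) \<gamma>"
  have t: "?t \<alpha> = (if take p \<gamma> = \<alpha> then (nc_inverse b \<alpha> * b (drop p \<gamma>) / b \<gamma>) *\<^sub>R ell2_coord f \<gamma> else 0)"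
    if "length \<alpha> = p" for \<alpha>
  proof (cases "take p \<gamma> = \<alpha>")
    case True
    then have "\<alpha> @ drop p \<gamma> = \<gamma>" by (metis append_take_drop_id)
    then show ?thesis
      using that True b_pos[of "drop p \<gamma>"] b_pos[of \<gamma>]
      by (simp add: ell2_coord_word_creation ell2_coord_adj_word_creation)
  next
    case False
    then show ?thesis using that by (simp add: ell2_coord_word_creation)
  qed
  have "ell2_coord (defect_layer b (creation b) p f) \<gamma> = (\<Sum>\<alpha> | length \<alpha> = p. ?t \<alpha>)"
    by (simp add: defect_layer_def ell2_coord_sum scaleR_ell2.rep_eq)
  also have "\<dots> = (\<Sum>\<alpha> | length \<alpha> = p.
      if take p \<gamma> = \<alpha> then (nc_inverse b \<alpha> * b (drop p \<gamma>) / b \<gamma>) *\<^sub>R ell2_coord f \<gamma> else 0)"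
    using t by (intro sum.cong) auto
  finally show ?thesis by (simp add: finite_words_length_eq)
qed

lemma ell2_coord_sum_defect_layer:
  "ell2_coord (\<Sum>p\<le>k. defect_layer b (creation b) p f) \<gamma> = defect_multiplier k \<gamma> *\<^sub>R ell2_coord f \<gamma>"
  by (simp add: ell2_coord_sum ell2_coord_defect_layer defect_multiplier_def scaleR_left.sum)

text \<open>The coefficients of \<open>g\<^sup>-\<^sup>1 g = 1\<close> appear once every layer acting on \<open>e\<^sub>\<gamma>\<close> is included.\<close>

lemma defect_multiplier_eq_delta:
  assumes "length \<gamma> \<le> k"
  shows "defect_multiplier k \<gamma> = (if \<gamma> = [] then 1 else 0)"
proof -
  have "defect_multiplier k \<gamma> = (\<Sum>p\<le>length \<gamma>. nc_inverse b (take p \<gamma>) * b (drop p \<gamma>) / b \<gamma>)"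
    unfolding defect_multiplier_def using assms by (intro sum.mono_neutral_cong_right) auto
  also have "\<dots> = nc_mult (nc_inverse b) b \<gamma> / b \<gamma>"
    unfolding nc_mult_eq_sum_take_drop by (simp add: sum_divide_distrib)
  finally show ?thesis by (simp add: nc_mult_inverse_left b_Nil nc_one_def)
qed

text \<open>A diagonal entry is bounded by the operator norm on a unit basis vector. The bound is
  taken on the scalar Fock space, but the multiplier is the same for every coefficient
  space.\<close>

lemma abs_defect_multiplier_le:
  assumes "onorm (\<lambda>x :: 'n fock. \<Sum>p\<le>k. defect_layer b (creation b) p x) \<le> C"
  shows "\<bar>defect_multiplier k \<gamma>\<bar> \<le> C"
proof -
  let ?Q = "\<lambda>x :: 'n fock. \<Sum>p\<le>k. defect_layer b (creation b) p x"
  have Q: "bounded_linear ?Q"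
    by (intro bounded_clinear_imp_bounded_linear bounded_clinear_sum_op bounded_clinear_defect_layer
        bounded_clinear_creation)
  have "\<bar>defect_multiplier k \<gamma>\<bar> = norm (ell2_coord (?Q (fock_basis \<gamma>)) \<gamma>)"
    by (simp add: ell2_coord_sum_defect_layer fock_basis.rep_eq)
  also have "\<dots> \<le> norm (?Q (fock_basis \<gamma>))" by (rule norm_ell2_coord_le)
  also have "\<dots> \<le> C" using onorm[OF Q, of "fock_basis \<gamma>"] assms by (simp add: norm_fock_basis)
  finally show ?thesis .
qed

text \<open>Dominated convergence: the truncated multiplier agrees with the vacuum projection on
  words of length at most \<open>k\<close>, and the uniform bound controls the longer ones by the
  tail of a summable family.\<close>

lemma defect_layers_sums:
  fixes f g :: "('n list, 'd::chilbert_space) ell2"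
  assumes C: "\<And>k \<gamma>. \<bar>defect_multiplier k \<gamma>\<bar> \<le> C"
  shows "(\<lambda>p. cinner (defect_layer b (creation b) p f) g) sums cinner (ell2_coord f []) (ell2_coord g [])"
proof -
  let ?D = defect_multiplier
  let ?u = "\<lambda>\<gamma>. cinner (ell2_coord f \<gamma>) (ell2_coord g \<gamma>)"
  let ?\<delta> = "\<lambda>\<gamma>. if \<gamma> = [] then 1 else 0 :: real"
  have u: "?u summable_on UNIV"
    by (intro square_summable_cinner square_summable_ell2_coord)
  then have au: "(\<lambda>\<gamma>. cmod (?u \<gamma>)) summable_on UNIV"
    by (simp add: summable_on_iff_abs_summable_on_complex)
  let ?tail = "\<lambda>k. infsum (\<lambda>\<gamma>. cmod (?u \<gamma>)) UNIV - (\<Sum>\<gamma> | length \<gamma> \<le> k. cmod (?u \<gamma>))"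
  have "((\<lambda>k. \<Sum>\<gamma> | length \<gamma> \<le> k. cmod (?u \<gamma>)) \<longlongrightarrow> infsum (\<lambda>\<gamma>. cmod (?u \<gamma>)) UNIV) sequentially"
    using filterlim_compose[OF has_sum_infsum[OF au, unfolded has_sum_def] filterlim_words_length_le]
    by simp
  then have "(\<lambda>k. (C + 1) * ?tail k) \<longlonglongrightarrow> (C + 1) * (infsum (\<lambda>\<gamma>. cmod (?u \<gamma>)) UNIV - infsum (\<lambda>\<gamma>. cmod (?u \<gamma>)) UNIV)"
    by (intro tendsto_intros)
  then have lim0: "(\<lambda>k. (C + 1) * ?tail k) \<longlonglongrightarrow> 0" by simp
  have bound: "cmod (cinner (\<Sum>p\<le>k. defect_layer b (creation b) p f) g - ?u []) \<le> (C + 1) * ?tail k" for k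
  proof -
    let ?v = "\<lambda>\<gamma>. of_real (?D k \<gamma> - ?\<delta> \<gamma>) * ?u \<gamma>"
    \<comment> \<open>The majorant: no error on short words, at most \<open>C + 1\<close> times the
      term on the others, where the extra 1 pays for the vacuum indicator.\<close>
    let ?w = "\<lambda>\<gamma>. if length \<gamma> \<le> k then 0 else (C + 1) * cmod (?u \<gamma>)"
    have "(?w has_sum (C + 1) * ?tail k) UNIV"
    proof -
      have "((\<lambda>\<gamma>. if length \<gamma> \<le> k then cmod (?u \<gamma>) else 0) has_sum
          (\<Sum>\<gamma> | length \<gamma> \<le> k. cmod (?u \<gamma>))) UNIV"
        by (rule has_sum_cong_neutral[THEN iffD1, OF _ _ _ has_sum_finite[OF finite_words_length_le[of k]]])
          auto
      from has_sum_cmult_right[OF has_sum_diff[OF has_sum_infsum[OF au] this], of "C + 1"]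
      show ?thesis by (rule has_sum_cong[THEN iffD1, rotated]) auto
    qed
    moreover have vw: "cmod (?v \<gamma>) \<le> ?w \<gamma>" for \<gamma>
    proof (cases "length \<gamma> \<le> k")
      case True
      then show ?thesis by (simp add: defect_multiplier_eq_delta)
    next
      case False
      have "\<bar>?D k \<gamma> - ?\<delta> \<gamma>\<bar> \<le> C + 1" using C[of k \<gamma>] by auto
      with False show ?thesis by (auto simp: norm_mult intro: mult_right_mono)
    qed
    ultimately have av: "(\<lambda>\<gamma>. cmod (?v \<gamma>)) summable_on UNIV"
      by (rule summable_on_comparison_test[OF has_sum_imp_summable]) simp
    have "((\<lambda>\<gamma>. of_real (?D k \<gamma>) * ?u \<gamma>) has_sum cinner (\<Sum>p\<le>k. defect_layer b (creation b) p f) g) UNIV"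
    proof -
      have "((\<lambda>\<gamma>. cinner (ell2_coord (\<Sum>p\<le>k. defect_layer b (creation b) p f) \<gamma>) (ell2_coord g \<gamma>))
          has_sum cinner (\<Sum>p\<le>k. defect_layer b (creation b) p f) g) UNIV"
        unfolding cinner_ell2.rep_eq
        by (intro has_sum_infsum square_summable_cinner square_summable_ell2_coord)
      then show ?thesis by (simp add: ell2_coord_sum_defect_layer cinner_scaleR_left)
    qed
    moreover have "((\<lambda>\<gamma>. of_real (?\<delta> \<gamma>) * ?u \<gamma>) has_sum ?u []) UNIV"
      using has_sum_finite[of "{[]}" "\<lambda>\<gamma>. of_real (?\<delta> \<gamma>) * ?u \<gamma>"]
      by (intro has_sum_cong_neutral[THEN iffD1, of UNIV "{[]}"]) auto
    ultimately have "(?v has_sum cinner (\<Sum>p\<le>k. defect_layer b (creation b) p f) g - ?u []) UNIV"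
      using has_sum_diff by (fastforce simp: of_real_diff left_diff_distrib)
    then have "cmod (cinner (\<Sum>p\<le>k. defect_layer b (creation b) p f) g - ?u []) = cmod (infsum ?v UNIV)"
      by (simp add: infsumI)
    also have "\<dots> \<le> infsum (\<lambda>\<gamma>. cmod (?v \<gamma>)) UNIV" by (rule norm_infsum_bound[OF av])
    also have "\<dots> \<le> (C + 1) * ?tail k"
      by (rule has_sum_mono[OF has_sum_infsum[OF av] \<open>(?w has_sum _) UNIV\<close> vw])
    finally show ?thesis .
  qed
  have "(\<lambda>k. cinner (\<Sum>p\<le>k. defect_layer b (creation b) p f) g - ?u []) \<longlonglongrightarrow> 0"
    by (rule Lim_null_comparison[OF always_eventually lim0]) (use bound in blast)
  then show ?thesis
    unfolding sums_def_le by (simp add: cinner_sum_left LIM_zero_iff)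
qed

end

lemma admissible_weight_family: "admissible b \<Longrightarrow> weight_family b"
  by (simp add: admissible_def weight_family_def)

lemma admissible_defect_multiplier_bound:
  fixes b :: "'n::finite list \<Rightarrow> real"
  assumes "admissible b"
  obtains C where "\<And>k \<gamma>. \<bar>weight_family.defect_multiplier b k \<gamma>\<bar> \<le> C"
proof -
  interpret weight_family b using assms by (rule admissible_weight_family)
  have "weighted_creation b = creation b" by (rule ext) (rule weighted_creation_eq_creation)
  then have "bdd_above (range (\<lambda>k. onorm (\<lambda>x :: 'n fock. \<Sum>p\<le>k. defect_layer b (creation b) p x)))"
    using assms by (simp add: admissible_def defect_layer_def)
  then obtain C where C: "\<And>k. onorm (\<lambda>x :: 'n fock. \<Sum>p\<le>k. defect_layer b (creation b) p x) \<le> C"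
    unfolding bdd_above_def by auto
  show ?thesis by (rule that[of C]) (rule abs_defect_multiplier_le[OF C])
qed

section \<open>Coinvariant models and pure tuples\<close>

lemma defect_sums_iff: "defect_sums b X \<Delta> \<longleftrightarrow> wot_sums (defect_layer b X) \<Delta>"
  by (simp add: defect_sums_def defect_layer_def[abs_def])

lemma defect_eqI:
  assumes "defect_sums b X \<Delta>"
  shows "defect b X = \<Delta>"
  unfolding defect_def
proof (rule the_equality[where P = "defect_sums b X", OF assms])
  have sums: "(\<lambda>p. cinner (defect_layer b X p x) y) sums cinner (S x) y" if "defect_sums b X S" for S x y
    using that by (simp add: defect_sums_iff wot_sums_def)
  fix \<Delta>' assume "defect_sums b X \<Delta>'"
  then have "cinner (\<Delta>' x) y = cinner (\<Delta> x) y" for x y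
    by (intro sums_unique2[OF sums sums[OF assms]])
  then show "\<Delta>' = \<Delta>" by (rule ext[OF cinner_ext])
qed

lemma pure_tuple_positive_defect: "pure_tuple b T \<Longrightarrow> positive_op (defect b T)"
  by (auto simp: pure_tuple_def nc_domain_def dest: defect_eqI)

lemma pure_tuple_bounded_clinear: "pure_tuple b T \<Longrightarrow> bounded_clinear (T i)"
  by (simp add: pure_tuple_def nc_domain_def)

lemma closed_csubspace_defect_space:
  "pure_tuple b T \<Longrightarrow> closed_csubspace (defect_space b T)"
  unfolding defect_space_def
  by (intro closed_csubspace_closure_range positive_op_imp_bounded_clinear pure_tuple_positive_defect)

text \<open>Polarization for the real part; replacing \<open>y\<close> by
  \<open>\<i> *\<^sub>C y\<close> gives the imaginary part.\<close>

lemma cisometry_cinner: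
  assumes V: "cisometry V"
  shows "cinner (V x) (V y) = cinner x y"
proof -
  have bV: "bounded_clinear V" and norm: "norm (V z) = norm z" for z
    using V by (auto simp: cisometry_def)
  have inner: "inner (V x) (V y) = inner x y" for x y
    by (simp add: dot_norm norm flip: bounded_clinear_add[OF bV])
  then show ?thesis
    using inner[of x y] inner[of x "\<i> *\<^sub>C y"]
    by (simp add: complex_eq_iff inner_eq_Re_cinner bounded_clinear_scaleC[OF bV] cinner_scaleC_right)
qed

section \<open>The two directions of the equivalence\<close>

context weight_family
begin

lemma pure_tuple_if_intertwining:
  fixes T :: "'n \<Rightarrow> 'h::chilbert_space \<Rightarrow> 'h" and V :: "'h \<Rightarrow> ('n list, 'd::chilbert_space) ell2"
  assumes C: "\<And>k \<gamma>. \<bar>defect_multiplier k \<gamma>\<bar> \<le> C"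
    and T: "\<And>i. bounded_clinear (T i)" and V: "cisometry V"
    and VT: "\<And>i h. V (adj (T i) h) = adj (creation b i) (V h)"
  shows "pure_tuple b T"
proof -
  have bV: "bounded_clinear V" using V by (simp add: cisometry_def)
  have VT\<alpha>: "V (adj (word_op T \<alpha>) h) = adj (word_op (creation b) \<alpha>) (V h)" for \<alpha> h
  proof (induction \<alpha> arbitrary: h)
    case Nil
    then show ?case by (simp add: adj_id[unfolded id_def] id_def)
  next
    case (Cons i \<alpha>)
    then show ?case
      by (simp add: adj_word_op_Cons T bounded_clinear_creation VT del: word_op.simps)
  qed
  \<comment> \<open>The vacuum coordinate of \<open>V\<close>; the defect of \<open>T\<close> will
    be the positive operator \<open>adj E \<circ> E\<close>.\<close>
  define E where "E = (\<lambda>h. ell2_coord (V h) [])"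
  define \<Delta> where "\<Delta> = adj E \<circ> E"
  have bE: "bounded_clinear E"
    unfolding E_def using bounded_clinear_compose[OF bounded_clinear_ell2_coord bV] by (simp add: o_def)
  have p\<Delta>: "positive_op \<Delta>" unfolding \<Delta>_def by (rule adj_self_compose_positive[OF bE])
  have cinner_\<Delta>: "cinner (\<Delta> x) y = cinner (E x) (E y)" for x y
    by (simp add: \<Delta>_def cinner_adj_left[OF bE])
  \<comment> \<open>The form of a layer involves only adjoints of words, which \<open>V\<close>
    carries from \<open>T\<close> to the creation operators while preserving inner products.\<close>
  have layer: "cinner (defect_layer b T p x) y = cinner (defect_layer b (creation b) p (V x)) (V y)" for p x y
    by (simp add: cinner_defect_layer T bounded_clinear_creation cisometry_cinner[OF V] flip: VT\<alpha>)
  have sums: "defect_sums b T \<Delta>"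
    unfolding defect_sums_iff wot_sums_def layer cinner_\<Delta>
    by (auto simp: E_def intro: positive_op_imp_bounded_clinear[OF p\<Delta>] defect_layers_sums[OF C])
  have "cinner (b \<alpha> *\<^sub>R word_op T \<alpha> (\<Delta> (adj (word_op T \<alpha>) x))) y
      = cinner (ell2_coord (V x) \<alpha>) (ell2_coord (V y) \<alpha>)" for \<alpha> x y
  proof -
    have "cinner (b \<alpha> *\<^sub>R word_op T \<alpha> (\<Delta> (adj (word_op T \<alpha>) x))) y
        = b \<alpha> * cinner (E (adj (word_op T \<alpha>) x)) (E (adj (word_op T \<alpha>) y))"
      by (simp add: cinner_scaleR_left bounded_clinear_word_op T flip: cinner_adj_right cinner_\<Delta>)
    \<comment> \<open>The vacuum coordinate after the adjoint of the word \<alpha> is coordinate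
      \<alpha> divided by \<open>sqrt (b \<alpha>)\<close>; the two factors cancel
      \<open>b \<alpha>\<close>.\<close>
    then show ?thesis
      using b_pos[of \<alpha>]
      by (simp add: E_def VT\<alpha> ell2_coord_adj_word_creation b_Nil cinner_scaleR_left cinner_scaleR_right
          flip: of_real_mult mult.assoc)
  qed
  moreover have "((\<lambda>\<alpha>. cinner (ell2_coord (V x) \<alpha>) (ell2_coord (V y) \<alpha>)) has_sum cinner x y) UNIV" for x y
    unfolding cisometry_cinner[OF V, of x y, symmetric] cinner_ell2.rep_eq
    by (intro has_sum_infsum square_summable_cinner square_summable_ell2_coord)
  ultimately have berezin: "berezin_sums b T id"
    unfolding berezin_sums_def wot_has_sum_def defect_eqI[OF sums] by (simp add: bounded_clinear_id)
  have "op_le id (id :: 'h \<Rightarrow> 'h)"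
    by (simp add: op_le_def positive_op_def bounded_clinear_const_zero)
  with T p\<Delta> sums berezin show ?thesis
    unfolding pure_tuple_def nc_domain_def by blast
qed

lemma pure_tuple_if_coinvariant_model:
  fixes T :: "'n \<Rightarrow> 'h::chilbert_space \<Rightarrow> 'h" and D :: "'d::chilbert_space set"
  assumes "\<And>k \<gamma>. \<bar>defect_multiplier k \<gamma>\<bar> \<le> C" "\<And>i. bounded_clinear (T i)"
    and "has_coinvariant_model b T D"
  shows "pure_tuple b T"
proof -
  obtain V :: "'h \<Rightarrow> ('n list, 'd) ell2"
    where "cisometry V" "\<And>i h. V (adj (T i) h) = adj (creation b i) (V h)"
    using assms(3) unfolding has_coinvariant_model_def ampliation_adj_weighted_creation by auto
  with assms(1,2) show ?thesis by (rule pure_tuple_if_intertwining)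
qed

text \<open>The purity identity evaluated at \<open>(h, h)\<close>, with the defect split into two
  self-adjoint roots. It gives both square summability and the norm of the Berezin kernel.\<close>

lemma pure_tuple_has_sum:
  assumes pure: "pure_tuple b T"
  defines "R \<equiv> sqrt_op (defect b T)"
  shows "((\<lambda>\<alpha>. (norm (sqrt (b \<alpha>) *\<^sub>R R (adj (word_op T \<alpha>) h)))\<^sup>2) has_sum (norm h)\<^sup>2) UNIV"
proof -
  note pos = pure_tuple_positive_defect[OF pure] and T = pure_tuple_bounded_clinear[OF pure]
  have "cinner (b \<alpha> *\<^sub>R word_op T \<alpha> (defect b T (adj (word_op T \<alpha>) h))) h
      = of_real ((norm (sqrt (b \<alpha>) *\<^sub>R R (adj (word_op T \<alpha>) h)))\<^sup>2)" for \<alpha>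
  proof -
    have "cinner (word_op T \<alpha> (defect b T (adj (word_op T \<alpha>) h))) h
        = cinner (R (R (adj (word_op T \<alpha>) h))) (adj (word_op T \<alpha>) h)"
      unfolding R_def sqrt_op_square[OF pos] by (simp add: cinner_adj_right bounded_clinear_word_op T)
    also have "\<dots> = of_real ((norm (R (adj (word_op T \<alpha>) h)))\<^sup>2)"
      unfolding R_def by (simp add: positive_op_selfadjoint[OF positive_sqrt_op[OF pos]] cinner_self)
    finally show ?thesis
      using b_pos[of \<alpha>] by (simp add: cinner_scaleR_left power_mult_distrib)
  qed
  moreover have "((\<lambda>\<alpha>. cinner (b \<alpha> *\<^sub>R word_op T \<alpha> (defect b T (adj (word_op T \<alpha>) h))) h) has_sum cinner h h) UNIV"
    using pure by (simp add: pure_tuple_def berezin_sums_def wot_has_sum_def)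
  ultimately have "((\<lambda>\<alpha>. complex_of_real ((norm (sqrt (b \<alpha>) *\<^sub>R R (adj (word_op T \<alpha>) h)))\<^sup>2))
      has_sum of_real ((norm h)\<^sup>2)) UNIV"
    by (simp only: cinner_self)
  then show ?thesis by (simp only: has_sum_of_real_iff)
qed

text \<open>The series defining the kernel is the basis expansion of the square-summable family
  \<open>?k\<close>, hence converges to it in norm.\<close>

lemma ell2_coord_berezin_kernel:
  assumes pure: "pure_tuple b T"
  shows "ell2_coord (berezin_kernel b T h) \<alpha> = sqrt (b \<alpha>) *\<^sub>R sqrt_op (defect b T) (adj (word_op T \<alpha>) h)"
proof -
  let ?k = "\<lambda>\<alpha>. sqrt (b \<alpha>) *\<^sub>R sqrt_op (defect b T) (adj (word_op T \<alpha>) h)"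
  have "square_summable ?k"
    using pure_tuple_has_sum[OF pure, of h] by (auto simp: square_summable_def summable_on_def)
  then have k: "ell2_coord (Abs_ell2 ?k) = ?k" by (simp add: Abs_ell2_inverse)
  have "tensor f (r *\<^sub>R d) = r *\<^sub>R tensor f d" for f :: "'n fock" and r and d :: 'a
    by (rule ell2_eqI) (simp add: tensor.rep_eq scaleR_ell2.rep_eq scaleC_scaleR)
  then have "berezin_kernel b T h = Abs_ell2 ?k"
    using infsumI[OF tensor_basis_has_sum[of "Abs_ell2 ?k"]] by (simp add: berezin_kernel_def k)
  then show ?thesis by (simp add: k)
qed

lemma cisometry_berezin_kernel:
  assumes pure: "pure_tuple b T"
  shows "cisometry (berezin_kernel b T)"
proof -
  have R: "bounded_clinear (sqrt_op (defect b T))"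
    by (intro positive_op_imp_bounded_clinear positive_sqrt_op pure_tuple_positive_defect pure)
  have A: "bounded_clinear (adj (word_op T \<alpha>))" for \<alpha>
    by (intro bounded_clinear_adj bounded_clinear_word_op pure_tuple_bounded_clinear[OF pure])
  note coord = ell2_coord_berezin_kernel[OF pure]
  have norm: "norm (berezin_kernel b T h) = norm h" for h
  proof -
    have "(norm (berezin_kernel b T h))\<^sup>2 = (norm h)\<^sup>2"
      unfolding norm_ell2_power2 coord by (rule infsumI[OF pure_tuple_has_sum[OF pure]])
    then show ?thesis by simp
  qed
  have "bounded_clinear (berezin_kernel b T)"
    by (rule bounded_clinear_intro[where K = 1])
      (auto intro!: ell2_eqI simp: norm coord plus_ell2.rep_eq scaleC_ell2.rep_eq scaleR_add_right
        scaleC_scaleR bounded_clinear_add[OF A] bounded_clinear_add[OF R] bounded_clinear_scaleC[OF A]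
        bounded_clinear_scaleC[OF R])
  with norm show ?thesis by (simp add: cisometry_def)
qed

lemma berezin_kernel_intertwining:
  assumes pure: "pure_tuple b T"
  shows "berezin_kernel b T (adj (T i) h) = adj (creation b i) (berezin_kernel b T h)"
proof (rule ell2_eqI)
  fix \<alpha>
  show "ell2_coord (berezin_kernel b T (adj (T i) h)) \<alpha> = ell2_coord (adj (creation b i) (berezin_kernel b T h)) \<alpha>"
    \<comment> \<open>The adjoint of the word \<open>i # \<alpha>\<close> absorbs the adjoint of
      \<open>T i\<close>, and the weight ratio times \<open>sqrt (b (i # \<alpha>))\<close> is
      \<open>sqrt (b \<alpha>)\<close>.\<close>
    using b_pos[of "i # \<alpha>"]
    by (simp add: ell2_coord_berezin_kernel[OF pure] ell2_coord_adj_creation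
        adj_word_op_Cons[OF pure_tuple_bounded_clinear[OF pure]] real_sqrt_divide del: word_op.simps)
qed

lemma berezin_kernel_in_fock_tensor:
  assumes pure: "pure_tuple b T"
  shows "berezin_kernel b T h \<in> fock_tensor (defect_space b T)"
proof (rule in_fock_tensorI)
  show "ell2_coord (berezin_kernel b T h) \<alpha> \<in> defect_space b T" for \<alpha>
    unfolding ell2_coord_berezin_kernel[OF pure]
    by (rule closed_csubspace_scaleR[OF closed_csubspace_defect_space[OF pure]])
      (simp add: defect_space_def sqrt_op_range pure_tuple_positive_defect[OF pure])
qed

lemma coinvariant_model_if_pure_tuple:
  assumes pure: "pure_tuple b T"
  shows "has_coinvariant_model b T (defect_space b T)"
  unfolding has_coinvariant_model_def ampliation_weighted_creation ampliation_adj_weighted_creation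
  by (intro conjI exI[of _ "berezin_kernel b T"] closed_csubspace_defect_space cisometry_berezin_kernel pure)
    \<comment> \<open>Read from right to left, the intertwining relation also shows that the range
      is coinvariant.\<close>
    (auto simp: berezin_kernel_in_fock_tensor pure berezin_kernel_intertwining[OF pure, symmetric])

end

text \<open>The defect space lies in \<open>'h\<close>, so existence of a model can be asserted over
  subsets of \<open>'h\<close>; the conjunct with \<open>'d\<close> covers models over any ambient
  space, since types cannot be quantified inside a formula.\<close>

theorem theorem1p12:
  fixes b :: "'n::finite list \<Rightarrow> real"
    and T :: "'n \<Rightarrow> 'h::chilbert_space \<Rightarrow> 'h"
  assumes "admissible b"
    and "\<And>i. bounded_clinear (T i)"
  shows "((\<exists>D :: 'h set. has_coinvariant_model b T D) \<longleftrightarrow> pure_tuple b T) \<and>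
    (\<forall>D :: 'd::chilbert_space set. has_coinvariant_model b T D \<longrightarrow> pure_tuple b T) \<and>
    (pure_tuple b T \<longrightarrow>
      closed_csubspace (defect_space b T) \<and>
      range (berezin_kernel b T) \<subseteq> fock_tensor (defect_space b T) \<and>
      (\<forall>i h. berezin_kernel b T (adj (T i) h) =
        ampliation (adj (weighted_creation b i)) (berezin_kernel b T h)) \<and>
      cisometry (berezin_kernel b T))"
proof -
  interpret weight_family b using assms(1) by (rule admissible_weight_family)
  obtain C where C: "\<And>k \<gamma>. \<bar>defect_multiplier k \<gamma>\<bar> \<le> C"
    using admissible_defect_multiplier_bound[OF assms(1)] by blast
  \<comment> \<open>Polymorphic in the ambient space of the model, so it serves both
    \<open>'h\<close> and \<open>'d\<close>.\<close>
  note model = pure_tuple_if_coinvariant_model[OF C assms(2)]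
  show ?thesis
    unfolding ampliation_adj_weighted_creation
  proof (intro conjI iffI allI impI)
    show "pure_tuple b T" if "\<exists>D :: 'h set. has_coinvariant_model b T D"
      using that model by (elim exE)
    show "pure_tuple b T" if "has_coinvariant_model b T D" for D :: "'d set"
      using that by (rule model)
  next
    assume pure: "pure_tuple b T"
    show "\<exists>D :: 'h set. has_coinvariant_model b T D"
      by (rule exI) (rule coinvariant_model_if_pure_tuple[OF pure])
    show "closed_csubspace (defect_space b T)" by (rule closed_csubspace_defect_space[OF pure])
    show "range (berezin_kernel b T) \<subseteq> fock_tensor (defect_space b T)"
      using berezin_kernel_in_fock_tensor[OF pure] by (intro image_subsetI)
    show "berezin_kernel b T (adj (T i) h) = adj (creation b i) (berezin_kernel b T h)" for i h
      by (rule berezin_kernel_intertwining[OF pure])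
    show "cisometry (berezin_kernel b T)" by (rule cisometry_berezin_kernel[OF pure])
  qed
qed

end
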